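(* Let $G=\mathbb{Z}_p\times\mathbb{Z}_4$ for an odd prime $p$, let $S$ be a proper subset of $G\setminus\{0\}$ that generates $G$, and let $S_0=S\cup\{0\}$. Let $0\in C\subseteq G$. Then $C$ is a perfect code in $\mathrm{Cay}(G,S)$ if and only if, for some integer parameters, $(S_0,C)$ is one of the following pairs: (1) $S_0=\{(\alpha_i,i+2\alpha_i)\mid i\in[2]\}$, $C=\{(i,2j)\mid i\in[p],j\in[2]\}$; (2) $S_0=\{(i,\alpha_i)\mid i\in[p]\}$, $C=\{(0,i)\mid i\in[4]\}$; (3) $S_0=\{(i,\alpha_i+2j)\mid i\in[p],j\in[2]\}$, $C=\{(0,i+2\lambda_i)\mid i\in[2]\}$; (4) $S_0=\{(j,i+2\alpha_i)\mid i\in[2],j\in[p]\}$, $C=\{(\lambda_i,2i)\mid i\in[2]\}$; (5) $S_0=\{(i,j+2\alpha_{ij})\mid i\in[p],j\in[2]\}$, $C=\{(0,2i)\mid i\in[2]\}$; (6) $S_0=\{(\alpha_i,i+2j)\mid i,j\in[2]\}$, $C=\{(i,2\lambda_i)\mid i\in[p]\}$; (7) $S_0=\{(\alpha_i,i)\mid i\in[4]\}$, $C=\{(i,0)\mid i\in[p]\}$.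
   Context: Groups are finite abelian, written additively; $\mathbb{Z}_n$ is the group of integers modulo $n$ and $[n]=\{0,1,\dots,n-1\}$; integers in coordinates are read modulo the relevant modulus. For $S\subseteq G\setminus\{0\}$, $\mathrm{Cay}(G,S)$ is the directed graph with vertex set $G$ and an arc from $x$ to $y$ if and only if $y-x\in S$ ($S$ is not assumed to be inverse-closed). A subset $C\subseteq G$ is a perfect code in $\mathrm{Cay}(G,S)$ if the sets $\{c\}\cup\{v:\text{there is an arc from } c \text{ to } v\}$, $c\in C$, form a partition of $G$. Greek letters with subscripts denote arbitrary integers, one for each value of the displayed indices, subject only to $\alpha_0=\lambda_0=\alpha_{00}=0$; different letters (or index patterns) denote independent families, and an integer occurring several times in one element is the same integer each time. *)

theory Defs
  imports
    "HOL-Algebra.Elementary_Groups"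
    "HOL-Library.Disjoint_Sets"
    "HOL-Computational_Algebra.Primes"
    "Graph_Theory.Pair_Digraph"
begin

text \<open>
  HOL-Algebra groups are written multiplicatively: \<open>y \<otimes>\<^bsub>G\<^esub> inv\<^bsub>G\<^esub> x\<close> is the additive \<open>y - x\<close>, and
  \<open>\<one>\<^bsub>G\<^esub>\<close> is \<open>0\<close>.
\<close>

definition cayley_digraph :: "('a, 'b) monoid_scheme \<Rightarrow> 'a set \<Rightarrow> 'a pair_pre_digraph" where
  "cayley_digraph G S =
     \<lparr> pverts = carrier G,
       parcs = {(x, y). x \<in> carrier G \<and> y \<in> carrier G \<and> y \<otimes>\<^bsub>G\<^esub> inv\<^bsub>G\<^esub> x \<in> S} \<rparr>"

definition closed_out_neighbourhood :: "('a, 'e) pre_digraph \<Rightarrow> 'a \<Rightarrow> 'a set" where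
  "closed_out_neighbourhood D c = {c} \<union> {v. c \<rightarrow>\<^bsub>D\<^esub> v}"

text \<open>
  The partition is one of an indexed family: distinct elements of \<open>C\<close> have disjoint (in
  particular, different) closed out-neighbourhoods.  Hence \<^const>\<open>disjoint_family_on\<close> rather than
  \<^const>\<open>partition_on\<close> applied to the set of these neighbourhoods, which would identify equal ones.
\<close>

definition perfect_code :: "('a, 'e) pre_digraph \<Rightarrow> 'a set \<Rightarrow> bool" where
  "perfect_code D C \<longleftrightarrow>
     C \<subseteq> verts D \<and>
     disjoint_family_on (closed_out_neighbourhood D) C \<and>
     (\<Union>c\<in>C. closed_out_neighbourhood D c) = verts D"

abbreviation Zp_Z4 :: "nat \<Rightarrow> (int \<times> int) monoid" where
  "Zp_Z4 p \<equiv> integer_mod_group p \<times>\<times> integer_mod_group 4"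

text \<open>
  The element of \<^term>\<open>Zp_Z4 p\<close> with the given integer coordinates; the carriers of
  \<^term>\<open>integer_mod_group p\<close> and \<^term>\<open>integer_mod_group 4\<close> consist of least non-negative residues.
\<close>

definition elt :: "nat \<Rightarrow> int \<Rightarrow> int \<Rightarrow> int \<times> int" where
  "elt p x y = (x mod int p, y mod 4)"

end

theory Submission
  imports Defs
begin

text \<open>
  The closed out-neighbourhood of \<open>c\<close> is the translate \<open>c + S\<^sub>0\<close>, so \<open>C\<close> is a perfect code exactly
  when every group element is a sum \<open>s + c\<close> in exactly one way (\<open>tiles\<close>, lemma
  \<open>perfect_code_iff_tiles\<close>): the theorem classifies the factorizations of
  \<open>\<int>\<^sub>p \<times> \<int>\<^sub>4\<close> into two factors containing \<open>0\<close>, the first of which generates the group.  Generation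
  enters through the two maximal subgroups: some element of \<open>S\<close> has nonzero first coordinate, and
  some element has odd second coordinate.

  The sizes of the factors multiply to \<open>4 * p\<close>.  The sizes \<open>1\<close> and \<open>4 * p\<close> are excluded for \<open>S\<^sub>0\<close>
  because \<open>S\<close> generates the group and is a proper subset of its nonzero elements.

  If one factor is a pair \<open>{0, d}\<close>, then the indicator function of the other factor flips under
  translation by \<open>d\<close>, hence is invariant under \<open>2 * d\<close>.  What this means depends on the order of \<open>d\<close>
  only, and \<open>alternating_function_cases\<close> goes through the possible orders.

  The remaining sizes are \<open>p\<close> and \<open>4\<close>, say \<open>A\<close> has \<open>p\<close> elements and \<open>B\<close> has four.  The key tool is
  \<open>periodic_convolution_eq_0\<close>: on \<open>\<int>\<^sub>N\<close> with \<open>N\<close> a power of a prime \<open>q\<close>, convolution with integer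
  weights whose sum is prime to \<open>q\<close> is injective on integer-valued functions.  Modulo \<open>q\<close> a translation
  is the identity plus a nilpotent operator, so the convolution is an invertible scalar plus a
  nilpotent operator.  This lemma is used three times.  Projecting the factorization to \<open>\<int>\<^sub>p\<close>
  shows that \<open>A\<close> meets each column once; projecting it to \<open>\<int>\<^sub>4\<close> shows that \<open>B\<close> meets each
  row once.  So \<open>A = {(x, \<alpha> x)}\<close> and \<open>B = {(\<beta> j, j)}\<close>, and the factorization says that for every
  \<open>x\<close> the four values \<open>\<alpha> (x - \<beta> j) + j\<close> are distinct modulo \<open>4\<close>.  Two of these values are odd,
  which is a convolution identity between the parity of \<open>\<alpha>\<close> and the signed multiset
  \<open>\<beta> 0 - \<beta> 1 + \<beta> 2 - \<beta> 3\<close>.  If \<open>\<alpha>\<close> takes an odd value, the number of odd values is positive and less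
  than \<open>p\<close>, so the third use of the lemma makes the signed multiset vanish.  This leads to
  \<open>transversal_trichotomy\<close>: either \<open>\<alpha>\<close> vanishes, or all \<open>\<alpha> x\<close> are even and \<open>\<beta>\<close> depends on the parity
  of \<open>j\<close> only, or \<open>\<beta>\<close> vanishes.  The generation conditions remove the impossible alternatives.
\<close>

section \<open>Convolutions of periodic integer functions\<close>

definition fwd_diff :: "(int \<Rightarrow> int) \<Rightarrow> int \<Rightarrow> int" where
  "fwd_diff f x = f (x + 1) - f x"

text \<open>
  Translation by one is the identity plus \<^const>\<open>fwd_diff\<close>; this is the binomial theorem for its
  \<open>n\<close>-th power.
\<close>

lemma newton_forward_formula:
  "f (x + int n) = (\<Sum>k\<le>n. int (n choose k) * (fwd_diff ^^ k) f x)"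
proof (induction n arbitrary: x)
  case 0
  then show ?case by simp
next
  case (Suc n)
  define t where "t k = (fwd_diff ^^ k) f x" for k
  have step: "(fwd_diff ^^ k) f (x + 1) = t k + t (Suc k)" for k
    by (simp add: t_def fwd_diff_def)
  have "f (x + int (Suc n)) = f ((x + 1) + int n)"
    by (simp add: algebra_simps)
  also have "\<dots> = (\<Sum>k\<le>n. int (n choose k) * t (Suc k)) + (\<Sum>k\<le>n. int (n choose k) * t k)"
    unfolding Suc.IH step by (simp add: algebra_simps sum.distrib)
  also have "(\<Sum>k\<le>n. int (n choose k) * t k) = (\<Sum>k\<le>Suc n. int (n choose k) * t k)"
    by simp
  also have "\<dots> = t 0 + (\<Sum>k\<le>n. int (n choose Suc k) * t (Suc k))"
    by (subst sum.atMost_Suc_shift) simp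
  finally show ?case
    unfolding t_def [symmetric] by (subst sum.atMost_Suc_shift) (simp add: algebra_simps sum.distrib)
qed

lemma prime_dvd_prime_power_choose:
  fixes q n k :: nat
  assumes "prime q" "0 < k" "k < q ^ n"
  shows "q dvd (q ^ n choose k)"
proof (rule ccontr)
  assume "\<not> q dvd (q ^ n choose k)"
  then have "coprime (q ^ n) (q ^ n choose k)"
    using assms(1) by (simp add: prime_imp_coprime)
  moreover have "q ^ n dvd (q ^ n choose k) * k"
  proof -
    have "k * (q ^ n choose k) = q ^ n * ((q ^ n - 1) choose (k - 1))"
      using assms(2) by (rule times_binomial_minus1_eq)
    then show ?thesis
      by (metis dvd_triv_left mult.commute)
  qed
  ultimately have "q ^ n dvd k"
    by (simp add: coprime_dvd_mult_right_iff)
  then show False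
    using assms by (auto dest: dvd_imp_le)
qed

text \<open>
  In characteristic \<open>q\<close> the \<open>q ^ n\<close>-th power of the difference operator is translation by \<open>q ^ n\<close>
  minus the identity, since the inner binomial coefficients vanish; on functions of that
  period it is zero.
\<close>

lemma fwd_diff_nilpotent:
  fixes q n :: nat
  assumes "prime q" and per: "\<And>x. f (x + int (q ^ n)) = f x"
  shows "int q dvd (fwd_diff ^^ (q ^ n)) f x"
proof -
  let ?N = "q ^ n"
  let ?t = "\<lambda>k. int (?N choose k) * (fwd_diff ^^ k) f x"
  have N: "0 < ?N" using assms(1) by (simp add: prime_gt_0_nat)
  have split: "{..?N} = insert 0 (insert ?N {0<..<?N})" using N by auto
  have "f x = f (x + int ?N)" using per by simp
  also have "\<dots> = (\<Sum>k\<le>?N. ?t k)" by (rule newton_forward_formula)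
  also have "\<dots> = f x + (fwd_diff ^^ ?N) f x + (\<Sum>k\<in>{0<..<?N}. ?t k)"
    unfolding split using N by simp
  finally have "(fwd_diff ^^ ?N) f x = - (\<Sum>k\<in>{0<..<?N}. ?t k)" by simp
  moreover have "int q dvd (\<Sum>k\<in>{0<..<?N}. ?t k)"
    by (intro dvd_sum dvd_mult2)
      (use prime_dvd_prime_power_choose [OF assms(1)] in auto)
  ultimately show ?thesis by simp
qed

lemma shift_congruent_imp_constant:
  fixes g :: "int \<Rightarrow> int" and d :: int
  assumes "\<And>x. d dvd g (x + 1) - g x"
  shows "d dvd g x - g y"
proof -
  have up: "d dvd g (z + int n) - g z" for z n
  proof (induction n)
    case (Suc n)
    from dvd_add [OF assms [of "z + int n"] Suc] show ?case by (simp add: algebra_simps)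
  qed simp
  show ?thesis
  proof (cases "y \<le> x")
    case True
    with up [of y "nat (x - y)"] show ?thesis by simp
  next
    case False
    with up [of x "nat (y - x)"] show ?thesis by (simp add: dvd_diff_commute)
  qed
qed

text \<open>
  If \<open>f\<close> is not zero modulo \<open>q\<close>, let \<open>g\<close> be the last iterated difference of \<open>f\<close> that is not zero modulo \<open>q\<close>.  Its own difference is
  zero modulo \<open>q\<close>, so \<open>g\<close> is constant modulo \<open>q\<close>, and convolution multiplies it by the sum of the
  weights.  But convolution commutes with differences, so it annihilates \<open>g\<close>, although
  that sum is a unit modulo \<open>q\<close>.
\<close>

lemma periodic_convolution_mod:
  fixes q n :: nat
  assumes q: "prime q" and per: "\<And>x. f (x + int (q ^ n)) = f x"
    and conv: "\<And>x. (\<Sum>j\<in>J. w j * f (x - c j)) = 0"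
    and w: "\<not> int q dvd sum w J"
  shows "int q dvd f x"
proof (rule ccontr)
  assume nz: "\<not> int q dvd f x"
  define P where "P m \<longleftrightarrow> (\<forall>x. int q dvd (fwd_diff ^^ m) f x)" for m
  have "P (q ^ n)" "\<not> P 0"
    using fwd_diff_nilpotent [where f = f and n = n, OF q per] nz by (auto simp: P_def)
  then obtain m where m: "\<not> P m" "P (Suc m)"
    by (metis ex_least_nat_less gr0I lessI order_refl)
  define g where "g = (fwd_diff ^^ m) f"
  have "int q dvd g (x + 1) - g x" for x
    using m(2) by (simp add: P_def g_def fwd_diff_def)
  then have const: "int q dvd g x - g y" for x y
    by (rule shift_congruent_imp_constant)
  have "(\<Sum>j\<in>J. w j * (fwd_diff ^^ k) f (x - c j)) = 0" for k x
  proof (induction k arbitrary: x)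
    case (Suc k)
    have "(\<Sum>j\<in>J. w j * (fwd_diff ^^ Suc k) f (x - c j)) =
      (\<Sum>j\<in>J. w j * (fwd_diff ^^ k) f (x + 1 - c j)) - (\<Sum>j\<in>J. w j * (fwd_diff ^^ k) f (x - c j))"
      by (simp add: fwd_diff_def sum_subtractf [symmetric] algebra_simps)
    then show ?case using Suc by simp
  qed (use conv in simp)
  then have conv_g: "(\<Sum>j\<in>J. w j * g (x - c j)) = 0" for x
    by (simp add: g_def)
  have "int q dvd g x" for x
  proof -
    have "int q dvd (\<Sum>j\<in>J. w j * (g x - g (x - c j)))"
      using const by (intro dvd_sum dvd_mult)
    also have "(\<Sum>j\<in>J. w j * (g x - g (x - c j))) = sum w J * g x"
      using conv_g by (simp add: right_diff_distrib sum_subtractf sum_distrib_right)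
    finally show ?thesis
      using w q by (simp add: prime_dvd_mult_iff)
  qed
  then show False using m(1) by (simp add: P_def g_def)
qed

text \<open>
  Descent: a solution is divisible by \<open>q\<close>, the quotient is again a solution, and so a
  solution is divisible by every power of \<open>q\<close>.
\<close>

lemma periodic_convolution_eq_0:
  fixes q n :: nat
  assumes q: "prime q" and per: "\<And>x. f (x + int (q ^ n)) = f x"
    and conv: "\<And>x. (\<Sum>j\<in>J. w j * f (x - c j)) = 0"
    and w: "\<not> int q dvd sum w J"
  shows "f x = 0"
proof -
  have *: "\<forall>x. int q ^ N dvd f x" for N
    using per conv
  proof (induction N arbitrary: f)
    case (Suc N)
    have "int q dvd f x" for x
      using periodic_convolution_mod [OF q Suc.prems w] .
    then obtain f' where f': "\<And>x. f x = int q * f' x"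
      unfolding dvd_def by metis
    have q0: "int q \<noteq> 0" using q by auto
    have "f' (x + int (q ^ n)) = f' x" for x
      using Suc.prems(1) [of x] q0 by (simp add: f')
    moreover have "(\<Sum>j\<in>J. w j * f' (x - c j)) = 0" for x
    proof -
      have "int q * (\<Sum>j\<in>J. w j * f' (x - c j)) = 0"
        using Suc.prems(2) [of x] by (simp add: f' sum_distrib_left algebra_simps)
      with q0 show ?thesis by simp
    qed
    ultimately have "\<forall>x. int q ^ N dvd f' x" by (rule Suc.IH)
    then show ?case by (simp add: f')
  qed simp
  show ?thesis
  proof (rule ccontr)
    assume "f x \<noteq> 0"
    moreover have "int q ^ nat \<bar>f x\<bar> dvd f x" using * by blast
    ultimately have "int q ^ nat \<bar>f x\<bar> \<le> \<bar>f x\<bar>" using dvd_imp_le_int [of "f x" "int q ^ nat \<bar>f x\<bar>"] by simp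
    moreover have "nat \<bar>f x\<bar> < q ^ nat \<bar>f x\<bar>"
      using prime_gt_1_nat [OF q] by (intro power_gt_expt) simp
    then have "int (nat \<bar>f x\<bar>) < int (q ^ nat \<bar>f x\<bar>)"
      by (simp only: of_nat_less_iff)
    ultimately show False by simp
  qed
qed

text \<open>
  If the sums of elements of \<open>A\<close> and \<open>B\<close> are equidistributed modulo \<open>q ^ n\<close>, then the fibre count of
  \<open>A\<close> minus its expected value \<open>1\<close> is annihilated by convolution with the multiset \<open>B\<close>.
\<close>

lemma card_fibre_eq_1:
  fixes q n :: nat and h :: "'g \<Rightarrow> int"
  assumes "prime q" "finite A" "finite B" "\<not> q dvd card B"
    and total: "\<And>x. card {(a, b). a \<in> A \<and> b \<in> B \<and> (h a + h b) mod int (q ^ n) = x mod int (q ^ n)} = card B"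
  shows "card {a \<in> A. h a mod int (q ^ n) = x mod int (q ^ n)} = 1"
proof -
  let ?m = "int (q ^ n)"
  define F where "F x = int (card {a \<in> A. h a mod ?m = x mod ?m}) - 1" for x
  have "F x = 0"
  proof (rule periodic_convolution_eq_0 [OF assms(1), where f = F and n = n and J = B and w = "\<lambda>_. 1" and c = h])
    show "F (x + ?m) = F x" for x by (simp add: F_def)
    show "(\<Sum>b\<in>B. 1 * F (x - h b)) = 0" for x
    proof -
      have "{(a, b). a \<in> A \<and> b \<in> B \<and> (h a + h b) mod ?m = x mod ?m} =
        prod.swap ` Sigma B (\<lambda>b. {a \<in> A. h a mod ?m = (x - h b) mod ?m})"
        by (auto simp: image_iff mod_eq_dvd_iff algebra_simps)
      then have "card B = card (Sigma B (\<lambda>b. {a \<in> A. h a mod ?m = (x - h b) mod ?m}))"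
        using total [of x] by (simp add: card_image)
      also have "\<dots> = (\<Sum>b\<in>B. card {a \<in> A. h a mod ?m = (x - h b) mod ?m})"
        using assms by (intro card_SigmaI) auto
      finally show ?thesis by (simp add: F_def sum_subtractf)
    qed
    show "\<not> int q dvd (\<Sum>b\<in>B. 1)" using assms by simp
  qed
  then show ?thesis by (simp add: F_def)
qed

section \<open>Periodic functions and residues modulo four\<close>

lemma periodic_mult:
  fixes f :: "int \<Rightarrow> 'a"
  assumes "\<And>x. f (x + m) = f x"
  shows "f (x + k * m) = f x"
proof (induction k rule: int_induct [where k = 0])
  case (step1 i)
  then show ?case using assms [of "x + i * m"] by (simp add: algebra_simps)
next
  case (step2 i)
  then show ?case using assms [of "x + (i - 1) * m"] by (simp add: algebra_simps)
qed simp

lemma periodic_mod_cong: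
  fixes f :: "int \<Rightarrow> 'a"
  assumes "\<And>x. f (x + m) = f x" "x mod m = y mod m"
  shows "f x = f y"
proof -
  have "f z = f (z mod m)" for z
    using periodic_mult [of f m "z mod m" "z div m", OF assms(1)] by (simp only: mod_div_mult_eq)
  then show ?thesis using assms(2) by metis
qed

lemma invariant_imp_constant:
  fixes f :: "int \<Rightarrow> 'a" and d m :: int
  assumes "\<And>x. f (x + m) = f x" "\<And>x. f (x + d) = f x" "coprime d m"
  shows "f x = f y"
proof -
  obtain u v where uv: "u * d + v * m = 1"
    using assms(3) by (metis bezout_int coprime_imp_gcd_eq_1)
  have "x = y + (x - y) * (u * d + v * m)" using uv by simp
  then have "x = (y + ((x - y) * v) * m) + ((x - y) * u) * d" by (simp add: algebra_simps)
  then show ?thesis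
    using periodic_mult [of f d] periodic_mult [of f m] assms(1,2) by metis
qed

lemma mod_4_cases:
  fixes x :: int
  obtains "x mod 4 = 0" | "x mod 4 = 1" | "x mod 4 = 2" | "x mod 4 = 3"
proof -
  have "x mod 4 = 0 \<or> x mod 4 = 1 \<or> x mod 4 = 2 \<or> x mod 4 = 3"
    by presburger
  then show thesis by (elim disjE) (fact that)+
qed

lemma add_mod_4: "(x + k) mod 4 = (x mod 4 + k) mod (4 :: int)"
  by (rule mod_add_left_eq [symmetric])

lemma even_mod_4: "even x \<longleftrightarrow> even (x mod (4 :: int))"
  by presburger

lemma mod_4_eq_if_even:
  fixes a b :: int
  assumes "even a" "even b" "a mod 4 \<noteq> (b + 2) mod 4"
  shows "a mod 4 = b mod 4"
  using assms unfolding add_mod_4 [of b] even_mod_4 [of a] even_mod_4 [of b]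
  by (cases a rule: mod_4_cases; cases b rule: mod_4_cases; simp)

lemma mod_4_eq_if_not_shifted:
  fixes a b :: int
  assumes "a mod 4 \<noteq> (b + 1) mod 4" "a mod 4 \<noteq> (b + 2) mod 4" "a mod 4 \<noteq> (b + 3) mod 4"
  shows "a mod 4 = b mod 4"
  using assms unfolding add_mod_4 [of b]
  by (cases a rule: mod_4_cases; cases b rule: mod_4_cases; simp)

lemma mod_4_shift_cong:
  "(a + k) mod 4 = (b + l) mod 4 \<longleftrightarrow> a mod 4 = (b + (l - k)) mod (4 :: int)"
  by (simp add: mod_eq_dvd_iff algebra_simps)

lemma mod_4_flip: "a mod 4 = (b + 3) mod 4 \<longleftrightarrow> b mod 4 = (a + 1) mod (4 :: int)"
  unfolding add_mod_4 [of a] add_mod_4 [of b]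
  by (cases a rule: mod_4_cases; cases b rule: mod_4_cases; simp)

lemma parity_balance_of_distinct_mod_4:
  fixes a b c d :: int
  assumes "distinct [a mod 4, (b + 1) mod 4, (c + 2) mod 4, (d + 3) mod 4]" (is "distinct ?xs")
  shows "a mod 2 + c mod 2 = b mod 2 + d mod 2"
proof -
  have "set ?xs = {0..<4}"
  proof (rule card_subset_eq)
    show "card (set ?xs) = card {0..<4 :: int}"
      using distinct_card [OF assms] by simp
  qed simp_all
  then have "sum_list (map (\<lambda>r. r mod 2) ?xs) = (\<Sum>r\<in>{0..<4}. r mod 2)"
    using sum_list_distinct_conv_sum_set [OF assms, of "\<lambda>r. r mod 2"] by (simp only:)
  also have "{0..<4} = {0, 1, 2, 3 :: int}" by auto
  finally have "a mod 2 + (b + 1) mod 2 + (c + 2) mod 2 + (d + 3) mod 2 = 2"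
    by (simp add: mod_mod_cancel)
  moreover have "(b + 1) mod 2 = 1 - b mod 2" "(c + 2) mod 2 = c mod 2" "(d + 3) mod 2 = 1 - d mod 2"
    by presburger+
  ultimately show ?thesis by linarith
qed

section \<open>Complementary transversals of the columns and of the rows\<close>

text \<open>
  If all \<open>\<alpha> x\<close> are even, comparing the values for \<open>j = 0, 2\<close> and for \<open>j = 1, 3\<close> shows that \<open>\<alpha>\<close> modulo
  \<open>4\<close> is invariant under \<open>\<beta> 2 - \<beta> 0\<close> and \<open>\<beta> 3 - \<beta> 1\<close>; a nonzero shift generates \<open>\<int>\<^sub>p\<close> and makes
  \<open>\<alpha>\<close> constant.  If \<open>\<alpha>\<close> takes an odd value, the parity balance and the injectivity of convolution give the
  equality of multisets \<open>{\<beta> 0, \<beta> 2} = {\<beta> 1, \<beta> 3}\<close> modulo \<open>p\<close>.  If the two members of this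
  multiset were different, \<open>\<alpha>\<close> would again be invariant under their difference, hence
  constant, although \<open>\<alpha> 0\<close> is even.
\<close>

lemma transversal_trichotomy:
  fixes p :: nat and \<alpha> \<beta> :: "int \<Rightarrow> int"
  assumes p: "prime p"
    and per: "\<And>x. \<alpha> (x + int p) = \<alpha> x" and \<alpha>0: "\<alpha> 0 mod 4 = 0" and \<beta>0: "\<beta> 0 mod int p = 0"
    and distinct: "\<And>x j k. j \<in> {0..<4} \<Longrightarrow> k \<in> {0..<4} \<Longrightarrow> j \<noteq> k \<Longrightarrow>
      (\<alpha> (x - \<beta> j) + j) mod 4 \<noteq> (\<alpha> (x - \<beta> k) + k) mod 4"
  shows "(\<forall>x. \<alpha> x mod 4 = 0) \<or>
    (\<forall>x. even (\<alpha> x)) \<and> \<beta> 2 mod int p = 0 \<and> \<beta> 3 mod int p = \<beta> 1 mod int p \<or>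
    (\<forall>j\<in>{0..<4}. \<beta> j mod int p = 0)"
proof -
  have const: "\<alpha> x mod 4 = 0" if "\<beta> j mod int p \<noteq> \<beta> k mod int p"
    and shift: "\<And>x. \<alpha> (x - \<beta> j) mod 4 = \<alpha> (x - \<beta> k) mod 4" for j k x
  proof -
    have "\<not> int p dvd \<beta> k - \<beta> j"
      using that(1) by (metis mod_eq_dvd_iff)
    then have "coprime (\<beta> k - \<beta> j) (int p)"
      using p by (simp add: prime_imp_coprime coprime_commute)
    moreover have "\<alpha> (x + (\<beta> k - \<beta> j)) mod 4 = \<alpha> x mod 4" for x
      using shift [of "x + \<beta> k"] by (simp add: algebra_simps)
    ultimately have "\<alpha> x mod 4 = \<alpha> 0 mod 4"
      using invariant_imp_constant [of "\<lambda>x. \<alpha> x mod 4" "int p" "\<beta> k - \<beta> j"] per by simp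
    with \<alpha>0 show ?thesis by simp
  qed
  define \<gamma> where "\<gamma> x j = (\<alpha> (x - \<beta> j) + j) mod 4" for x j
  have ne: "\<gamma> x 0 \<noteq> \<gamma> x 1" "\<gamma> x 0 \<noteq> \<gamma> x 2" "\<gamma> x 0 \<noteq> \<gamma> x 3"
    "\<gamma> x 1 \<noteq> \<gamma> x 2" "\<gamma> x 1 \<noteq> \<gamma> x 3" "\<gamma> x 2 \<noteq> \<gamma> x 3" for x
    unfolding \<gamma>_def by (rule distinct; simp)+
  note ne' = ne [unfolded \<gamma>_def]
  show ?thesis
  proof (cases "\<forall>x. even (\<alpha> x)")
    case True
    have "\<alpha> (x - \<beta> 0) mod 4 = \<alpha> (x - \<beta> 2) mod 4" for x
      using ne'(2) [of x] True by (intro mod_4_eq_if_even) simp_all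
    moreover have "\<alpha> (x - \<beta> 1) mod 4 = \<alpha> (x - \<beta> 3) mod 4" for x
      using ne'(5) [of x] True by (intro mod_4_eq_if_even) (simp_all add: mod_4_shift_cong)
    ultimately show ?thesis
      using True const \<beta>0 by metis
  next
    case False
    then obtain x1 where x1: "odd (\<alpha> x1)" by blast
    define e where "e x = \<alpha> x mod 2" for x
    have \<alpha>_cong: "\<alpha> x = \<alpha> y" if "x mod int p = y mod int p" for x y
      using per that by (rule periodic_mod_cong)
    then have e_mod: "e (x mod int p) = e x" for x
      unfolding e_def by (metis mod_mod_trivial)
    have p0: "0 < int p" using p by (simp add: prime_gt_0_nat)
    have e01: "0 \<le> e x" "e x \<le> 1" for x by (auto simp: e_def)
    have sum_e: "e (x - \<beta> 0) + e (x - \<beta> 2) = e (x - \<beta> 1) + e (x - \<beta> 3)" for x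
      unfolding e_def using ne' [of x]
      by (intro parity_balance_of_distinct_mod_4) simp
    \<comment> \<open>There is an odd value, and \<open>\<alpha> 0\<close> is even, so the number of odd values lies strictly
      between \<open>0\<close> and \<open>p\<close>.\<close>
    have "\<not> int p dvd sum e {0..<int p}"
    proof -
      have "0 < sum e {0..<int p}"
        using e01 p0 x1 e_mod [of x1]
        by (intro sum_pos2 [of _ "x1 mod int p"]) (auto simp: e_def odd_iff_mod_2_eq_one)
      moreover have "sum e {0..<int p} < (\<Sum>x\<in>{0..<int p}. 1)"
      proof (rule sum_strict_mono_ex1)
        have "e 0 = \<alpha> 0 mod 4 mod 2" by (simp add: e_def mod_mod_cancel)
        then have "e 0 < 1" using \<alpha>0 by simp
        then show "\<exists>x\<in>{0..<int p}. e x < 1" using p0 by force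
      qed (use e01 in auto)
      ultimately show ?thesis by (auto dest: zdvd_imp_le)
    qed
    \<comment> \<open>The signed multiset as a function on residues.  Here the parities serve as weights
      and the multiset as the unknown function, because the weights of the multiset sum to zero.\<close>
    define h where "h y = (if y mod int p = \<beta> 0 mod int p then 1 else 0)
      + (if y mod int p = \<beta> 2 mod int p then 1 else 0)
      - (if y mod int p = \<beta> 1 mod int p then 1 else 0)
      - (if y mod int p = \<beta> 3 mod int p then 1 else (0 :: int))" for y
    have pick: "(\<Sum>i\<in>{0..<int p}. e i * (if (x - i) mod int p = \<beta> j mod int p then 1 else 0)) = e (x - \<beta> j)" for x j
    proof -
      have "(x - i) mod int p = \<beta> j mod int p \<longleftrightarrow> i = (x - \<beta> j) mod int p" if "i \<in> {0..<int p}" for i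
      proof -
        have "(x - i) mod int p = \<beta> j mod int p \<longleftrightarrow> i mod int p = (x - \<beta> j) mod int p"
          by (simp add: mod_eq_dvd_iff) (simp add: dvd_diff_commute algebra_simps)
        with that show ?thesis by simp
      qed
      then have "(\<Sum>i\<in>{0..<int p}. e i * (if (x - i) mod int p = \<beta> j mod int p then 1 else 0))
        = (\<Sum>i\<in>{0..<int p}. if i = (x - \<beta> j) mod int p then e i else 0)"
        by (intro sum.cong) auto
      also have "\<dots> = e (x - \<beta> j)" using p0 e_mod by (simp add: sum.delta)
      finally show ?thesis .
    qed
    have h0: "h y = 0" for y
    proof (rule periodic_convolution_eq_0 [OF p, where f = h and n = 1 and J = "{0..<int p}" and w = e and c = "\<lambda>i. i"])
      show "h (x + int (p ^ 1)) = h x" for x by (simp add: h_def)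
      show "(\<Sum>i\<in>{0..<int p}. e i * h (x - i)) = 0" for x
        unfolding h_def distrib_left right_diff_distrib sum.distrib sum_subtractf pick
        using sum_e [of x] by simp
    qed fact
    show ?thesis
    proof (cases "\<beta> 2 mod int p = \<beta> 0 mod int p")
      case True
      then have "\<beta> 1 mod int p = 0" "\<beta> 3 mod int p = 0"
        using h0 [of "\<beta> 0"] \<beta>0 by (auto simp: h_def split: if_splits)
      moreover have "{0..<4} = {0, 1, 2, 3 :: int}" by auto
      ultimately show ?thesis using True \<beta>0 by simp
    next
      case ne2: False
      \<comment> \<open>In the first pairing the four distinct values are \<open>\<alpha> (x - \<beta> 0) + {0, 1}\<close> and
        \<open>\<alpha> (x - \<beta> 2) + {2, 3}\<close>, in the second one the increments are \<open>{0, 3}\<close> and \<open>{2, 1}\<close>.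
        Each time the two pairs are disjoint only if the values of \<open>\<alpha>\<close> agree.\<close>
      have cases: "\<beta> 1 mod int p = \<beta> 0 mod int p \<and> \<beta> 3 mod int p = \<beta> 2 mod int p \<or>
        \<beta> 3 mod int p = \<beta> 0 mod int p \<and> \<beta> 1 mod int p = \<beta> 2 mod int p"
        using h0 [of "\<beta> 0"] h0 [of "\<beta> 2"] ne2 by (auto simp: h_def split: if_splits)
      have "\<alpha> (x - \<beta> 0) mod 4 = \<alpha> (x - \<beta> 2) mod 4" for x
        using cases
      proof (elim disjE conjE)
        assume "\<beta> 1 mod int p = \<beta> 0 mod int p" "\<beta> 3 mod int p = \<beta> 2 mod int p"
        then have "\<alpha> (x - \<beta> 1) = \<alpha> (x - \<beta> 0)" "\<alpha> (x - \<beta> 3) = \<alpha> (x - \<beta> 2)"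
          by (auto intro!: \<alpha>_cong intro: mod_diff_cong)
        with ne'(2,3,4) [of x] show ?thesis
          by (intro mod_4_eq_if_not_shifted) (simp_all add: mod_4_shift_cong)
      next
        assume "\<beta> 3 mod int p = \<beta> 0 mod int p" "\<beta> 1 mod int p = \<beta> 2 mod int p"
        then have eqs: "\<alpha> (x - \<beta> 3) = \<alpha> (x - \<beta> 0)" "\<alpha> (x - \<beta> 1) = \<alpha> (x - \<beta> 2)"
          by (auto intro!: \<alpha>_cong intro: mod_diff_cong)
        have "\<alpha> (x - \<beta> 0) mod 4 \<noteq> (\<alpha> (x - \<beta> 2) + 3) mod 4"
        proof
          assume "\<alpha> (x - \<beta> 0) mod 4 = (\<alpha> (x - \<beta> 2) + 3) mod 4"
          then have "\<alpha> (x - \<beta> 2) mod 4 = (\<alpha> (x - \<beta> 0) + 1) mod 4"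
            by (simp only: mod_4_flip)
          then have "(\<alpha> (x - \<beta> 2) + 2) mod 4 = (\<alpha> (x - \<beta> 0) + 3) mod 4"
            using mod_4_shift_cong [of "\<alpha> (x - \<beta> 2)" 2 "\<alpha> (x - \<beta> 0)" 3] by simp
          with ne'(6) [of x] eqs show False by simp
        qed
        with ne'(1,2) [of x] eqs show ?thesis
          by (intro mod_4_eq_if_not_shifted) simp_all
      qed
      with const ne2 show ?thesis by metis
    qed
  qed
qed

section \<open>Perfect codes as tilings\<close>

declare carrier_DirProd [simp del] one_DirProd [simp del]

text \<open>
  The group is the direct sum of \<open>A\<close> and \<open>B\<close>: the summand in \<open>B\<close> determines the one in \<open>A\<close>.
  The sum is given by arbitrary integer coordinates, so that translations need no reduction.
\<close>

definition tiles :: "nat \<Rightarrow> (int \<times> int) set \<Rightarrow> (int \<times> int) set \<Rightarrow> bool" where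
  "tiles p A B \<longleftrightarrow> (\<forall>x y. \<exists>!b. b \<in> B \<and> elt p (x - fst b) (y - snd b) \<in> A)"

lemma carrier_Zp_Z4: "p > 0 \<Longrightarrow> carrier (Zp_Z4 p) = {0..<int p} \<times> {0..<4}"
  by (simp add: carrier_DirProd carrier_integer_mod_group)

lemma one_Zp_Z4: "\<one>\<^bsub>Zp_Z4 p\<^esub> = elt p 0 0"
  by (simp add: one_DirProd elt_def)

lemma elt_in_carrier: "p > 0 \<Longrightarrow> elt p x y \<in> carrier (Zp_Z4 p)"
  by (simp add: carrier_Zp_Z4 elt_def)

lemma elt_fst_snd: "p > 0 \<Longrightarrow> v \<in> carrier (Zp_Z4 p) \<Longrightarrow> elt p (fst v) (snd v) = v"
  by (auto simp: carrier_Zp_Z4 elt_def)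

lemma elt_eq_iff: "elt p x y = elt p x' y' \<longleftrightarrow> x mod int p = x' mod int p \<and> y mod 4 = y' mod 4"
  by (simp add: elt_def)

lemma elt_mod [simp]: "elt p (x mod int p) y = elt p x y" "elt p x (y mod 4) = elt p x y"
  by (simp_all add: elt_def)

lemma fst_elt [simp]: "fst (elt p x y) = x mod int p"
  and snd_elt [simp]: "snd (elt p x y) = y mod 4"
  by (simp_all add: elt_def)

lemma elt_diff_elt [simp]:
  "elt p (x - u mod int p) y = elt p (x - u) y" "elt p x (y - v mod 4) = elt p x (y - v)"
  by (simp_all add: elt_def mod_diff_right_eq)

lemma elt_periodic: "elt p (x + int p) y = elt p x y" "elt p x (y + 4) = elt p x y"
  by (simp_all add: elt_def)

lemma mem_elt_image_iff:
  "elt p x y \<in> {elt p (f i) (g i) | i. i \<in> I} \<longleftrightarrow>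
    (\<exists>i\<in>I. x mod int p = f i mod int p \<and> y mod 4 = g i mod 4)"
  by (auto simp: elt_eq_iff)

lemma mem_elt_image2_iff:
  "elt p x y \<in> {elt p (f i j) (g i j) | i j. i \<in> I \<and> j \<in> J} \<longleftrightarrow>
    (\<exists>i\<in>I. \<exists>j\<in>J. x mod int p = f i j mod int p \<and> y mod 4 = g i j mod 4)"
  by (auto simp: elt_eq_iff)

lemma subset_carrier_eqI:
  assumes "p > 0" "A \<subseteq> carrier (Zp_Z4 p)" "B \<subseteq> carrier (Zp_Z4 p)"
    and "\<And>x y. elt p x y \<in> A \<longleftrightarrow> elt p x y \<in> B"
  shows "A = B"
  using assms elt_fst_snd by (metis subsetD subsetI subset_antisym)

lemma closed_out_neighbourhood_cayley_digraph:
  assumes "p > 0" "c \<in> carrier (Zp_Z4 p)"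
  shows "closed_out_neighbourhood (with_proj (cayley_digraph (Zp_Z4 p) S)) c =
    {v \<in> carrier (Zp_Z4 p). elt p (fst v - fst c) (snd v - snd c) \<in> S \<union> {\<one>\<^bsub>Zp_Z4 p\<^esub>}}"
proof -
  have diff: "v \<otimes>\<^bsub>Zp_Z4 p\<^esub> inv\<^bsub>Zp_Z4 p\<^esub> c = elt p (fst v - fst c) (snd v - snd c)" for v
    using assms by (cases c; cases v)
      (simp add: elt_def carrier_DirProd carrier_integer_mod_group mod_add_right_eq)
  have "elt p (fst v - fst c) (snd v - snd c) = \<one>\<^bsub>Zp_Z4 p\<^esub> \<longleftrightarrow> v = c" if "v \<in> carrier (Zp_Z4 p)" for v
    using that assms elt_fst_snd [OF assms(1)] elt_eq_iff [of p "fst v" "snd v" "fst c" "snd c"]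
    by (auto simp: one_Zp_Z4 elt_eq_iff mod_eq_dvd_iff)
  then show ?thesis
    using assms by (auto simp: closed_out_neighbourhood_def cayley_digraph_def diff)
qed

lemma indexed_partition_iff_ex1:
  assumes "\<And>c. c \<in> C \<Longrightarrow> N c \<subseteq> G"
  shows "disjoint_family_on N C \<and> (\<Union>c\<in>C. N c) = G \<longleftrightarrow> (\<forall>v\<in>G. \<exists>!c. c \<in> C \<and> v \<in> N c)"
  (is "?L \<longleftrightarrow> ?R")
proof
  assume L: ?L
  show ?R
  proof
    fix v assume "v \<in> G"
    then obtain c where c: "c \<in> C" "v \<in> N c" using L by blast
    moreover have "c' = c" if "c' \<in> C" "v \<in> N c'" for c'
      using L c that disjoint_family_onD by fastforce
    ultimately show "\<exists>!c. c \<in> C \<and> v \<in> N c" by blast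
  qed
next
  assume R: ?R
  have "disjoint_family_on N C"
    unfolding disjoint_family_on_def
  proof (intro ballI impI equals0I)
    fix c c' v assume "c \<in> C" "c' \<in> C" "c \<noteq> c'" "v \<in> N c \<inter> N c'"
    moreover from this have "v \<in> G" using assms by blast
    ultimately show False using R by blast
  qed
  moreover have "(\<Union>c\<in>C. N c) = G" using R assms by fastforce
  ultimately show ?L by blast
qed

lemma perfect_code_iff_tiles:
  assumes p: "p > 0" and C: "C \<subseteq> carrier (Zp_Z4 p)"
  shows "perfect_code (with_proj (cayley_digraph (Zp_Z4 p) S)) C \<longleftrightarrow>
    tiles p (S \<union> {\<one>\<^bsub>Zp_Z4 p\<^esub>}) C"
proof -
  define G where "G = carrier (Zp_Z4 p)"
  define S0 where "S0 = S \<union> {\<one>\<^bsub>Zp_Z4 p\<^esub>}"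
  define N where "N = closed_out_neighbourhood (with_proj (cayley_digraph (Zp_Z4 p) S))"
  have N: "N c = {v \<in> G. elt p (fst v - fst c) (snd v - snd c) \<in> S0}" if "c \<in> C" for c
    unfolding N_def G_def S0_def using that C by (intro closed_out_neighbourhood_cayley_digraph [OF p]) blast
  have "verts (with_proj (cayley_digraph (Zp_Z4 p) S)) = G"
    by (simp add: cayley_digraph_def G_def)
  then have "perfect_code (with_proj (cayley_digraph (Zp_Z4 p) S)) C \<longleftrightarrow>
    disjoint_family_on N C \<and> (\<Union>c\<in>C. N c) = G"
    using C by (simp only: perfect_code_def N_def [symmetric] G_def [symmetric] simp_thms)
  also have "\<dots> \<longleftrightarrow> (\<forall>v\<in>G. \<exists>!c. c \<in> C \<and> v \<in> N c)"
    by (rule indexed_partition_iff_ex1) (use N in blast)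
  also have "\<dots> \<longleftrightarrow> (\<forall>v\<in>G. \<exists>!c. c \<in> C \<and> elt p (fst v - fst c) (snd v - snd c) \<in> S0)"
  proof (intro ball_cong refl)
    fix v assume "v \<in> G"
    then have "c \<in> C \<and> v \<in> N c \<longleftrightarrow> c \<in> C \<and> elt p (fst v - fst c) (snd v - snd c) \<in> S0" for c
      using N by blast
    then show "(\<exists>!c. c \<in> C \<and> v \<in> N c) \<longleftrightarrow> (\<exists>!c. c \<in> C \<and> elt p (fst v - fst c) (snd v - snd c) \<in> S0)"
      by simp
  qed
  also have "\<dots> \<longleftrightarrow> tiles p S0 C"
  proof
    assume *: "\<forall>v\<in>G. \<exists>!c. c \<in> C \<and> elt p (fst v - fst c) (snd v - snd c) \<in> S0"
    show "tiles p S0 C"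
      unfolding tiles_def
    proof (intro allI)
      fix x y
      have "elt p (x mod int p - u) (y mod 4 - v) = elt p (x - u) (y - v)" for u v
        by (simp add: elt_def mod_diff_left_eq)
      moreover have "elt p x y \<in> G" by (simp add: G_def elt_in_carrier [OF p])
      ultimately show "\<exists>!b. b \<in> C \<and> elt p (x - fst b) (y - snd b) \<in> S0"
        using * [rule_format, of "elt p x y"] by (simp only: fst_elt snd_elt)
    qed
  qed (simp add: tiles_def)
  finally show ?thesis by (simp only: S0_def)
qed

lemma tiles_commute:
  assumes p: "p > 0" and A: "A \<subseteq> carrier (Zp_Z4 p)" and B: "B \<subseteq> carrier (Zp_Z4 p)" and "tiles p A B"
  shows "tiles p B A"
  unfolding tiles_def
proof (intro allI)
  fix x y
  obtain b where b: "b \<in> B" "elt p (x - fst b) (y - snd b) \<in> A"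
    and uniq: "\<And>b'. b' \<in> B \<Longrightarrow> elt p (x - fst b') (y - snd b') \<in> A \<Longrightarrow> b' = b"
    using assms(4) unfolding tiles_def by metis
  show "\<exists>!a. a \<in> A \<and> elt p (x - fst a) (y - snd a) \<in> B"
  proof (intro ex1I conjI)
    show "elt p (x - fst b) (y - snd b) \<in> A" by fact
    show "elt p (x - fst (elt p (x - fst b) (y - snd b))) (y - snd (elt p (x - fst b) (y - snd b))) \<in> B"
      using b(1) B elt_fst_snd [OF p] by auto
  next
    fix a assume a: "a \<in> A \<and> elt p (x - fst a) (y - snd a) \<in> B"
    then have "elt p (x - fst a) (y - snd a) = b"
      using A elt_fst_snd [OF p] by (intro uniq) auto
    then have "elt p (x - fst b) (y - snd b) = elt p (fst a) (snd a)"
      by auto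
    with a A elt_fst_snd [OF p] show "a = elt p (x - fst b) (y - snd b)" by auto
  qed
qed

lemma ex1_pair_iff: "d \<noteq> c \<Longrightarrow> (\<exists>!z. z \<in> {c, d} \<and> Q z) \<longleftrightarrow> (Q c \<longleftrightarrow> \<not> Q d)"
  by auto

lemma tiles_pair_iff:
  assumes "elt p a b \<noteq> elt p 0 0"
  shows "tiles p A {elt p 0 0, elt p a b} \<longleftrightarrow>
    (\<forall>x y. elt p x y \<in> A \<longleftrightarrow> elt p (x - a) (y - b) \<notin> A)"
proof -
  have "elt p (x - fst (elt p 0 0)) (y - snd (elt p 0 0)) = elt p x y"
    "elt p (x - fst (elt p a b)) (y - snd (elt p a b)) = elt p (x - a) (y - b)" for x y
    by (simp_all only: fst_elt snd_elt elt_diff_elt diff_zero)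
  then show ?thesis
    unfolding tiles_def ex1_pair_iff [OF assms] by (simp only:)
qed

lemma tiles_bij_betw:
  assumes p: "p > 0" and A: "A \<subseteq> carrier (Zp_Z4 p)" and B: "B \<subseteq> carrier (Zp_Z4 p)" and t: "tiles p A B"
  shows "bij_betw (\<lambda>(a, b). elt p (fst a + fst b) (snd a + snd b)) (A \<times> B) (carrier (Zp_Z4 p))"
proof (rule bij_betwI')
  have sub: "elt p (fst g - fst b) (snd g - snd b) = a"
    if "a \<in> A" "g = elt p (fst a + fst b) (snd a + snd b)" for a b g
  proof -
    have "elt p (fst g - fst b) (snd g - snd b) = elt p (fst a) (snd a)"
      unfolding that(2) by (simp add: elt_def mod_diff_left_eq)
    then show ?thesis using that(1) A elt_fst_snd [OF p] by auto
  qed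
  show "((\<lambda>(a, b). elt p (fst a + fst b) (snd a + snd b)) z =
      (\<lambda>(a, b). elt p (fst a + fst b) (snd a + snd b)) z') = (z = z')"
    if z: "z \<in> A \<times> B" "z' \<in> A \<times> B" for z z'
  proof
    obtain a b a' b' where ab: "z = (a, b)" "z' = (a', b')" by (metis surj_pair)
    define g where "g = elt p (fst a + fst b) (snd a + snd b)"
    assume "(\<lambda>(a, b). elt p (fst a + fst b) (snd a + snd b)) z =
      (\<lambda>(a, b). elt p (fst a + fst b) (snd a + snd b)) z'"
    then have g': "g = elt p (fst a' + fst b') (snd a' + snd b')"
      by (simp add: ab g_def)
    note s = sub [of a g b, OF _ g_def] sub [of a' g b', OF _ g']
    have "b = b'" using t z s unfolding tiles_def ab by (metis mem_Sigma_iff)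
    moreover from this have "a = a'" using z s by (simp add: ab)
    ultimately show "z = z'" by (simp add: ab)
  qed simp
  show "(\<lambda>(a, b). elt p (fst a + fst b) (snd a + snd b)) z \<in> carrier (Zp_Z4 p)" for z
    by (simp add: elt_in_carrier [OF p] split: prod.split)
  show "\<exists>z\<in>A \<times> B. g = (\<lambda>(a, b). elt p (fst a + fst b) (snd a + snd b)) z"
    if g: "g \<in> carrier (Zp_Z4 p)" for g
  proof -
    obtain b where b: "b \<in> B" "elt p (fst g - fst b) (snd g - snd b) \<in> A"
      using t unfolding tiles_def by metis
    have "elt p (fst (elt p (fst g - fst b) (snd g - snd b)) + fst b)
      (snd (elt p (fst g - fst b) (snd g - snd b)) + snd b) = elt p (fst g) (snd g)"
      by (simp add: elt_def mod_add_left_eq)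
    then have "g = (\<lambda>(a, b). elt p (fst a + fst b) (snd a + snd b)) (elt p (fst g - fst b) (snd g - snd b), b)"
      using elt_fst_snd [OF p g] by simp
    with b show ?thesis by blast
  qed
qed

lemma card_carrier_Zp_Z4: "p > 0 \<Longrightarrow> card (carrier (Zp_Z4 p)) = 4 * p"
  by (simp only: carrier_Zp_Z4 card_cartesian_product) simp

lemma tiles_card:
  assumes "p > 0" "A \<subseteq> carrier (Zp_Z4 p)" "B \<subseteq> carrier (Zp_Z4 p)" "tiles p A B"
  shows "card A * card B = 4 * p"
  using bij_betw_same_card [OF tiles_bij_betw [OF assms]] card_carrier_Zp_Z4 [OF assms(1)]
  by (simp add: card_cartesian_product)

text \<open>
  Addition is a bijection from \<open>A \<times> B\<close> onto the group, so it can be used to count the pairs with a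
  sum of a given kind.
\<close>

lemma tiles_card_slice:
  assumes p: "p > 0" and A: "A \<subseteq> carrier (Zp_Z4 p)" and B: "B \<subseteq> carrier (Zp_Z4 p)" and t: "tiles p A B"
  shows "card {(a, b). a \<in> A \<and> b \<in> B \<and> Q (elt p (fst a + fst b) (snd a + snd b))} =
    card {g \<in> carrier (Zp_Z4 p). Q g}"
proof -
  let ?f = "\<lambda>(a, b). elt p (fst a + fst b) (snd a + snd b)"
  have bij: "bij_betw ?f (A \<times> B) (carrier (Zp_Z4 p))"
    by (rule tiles_bij_betw [OF assms])
  have "?f ` {(a, b). a \<in> A \<and> b \<in> B \<and> Q (?f (a, b))} = {g \<in> carrier (Zp_Z4 p). Q g}"
  proof (intro equalityI subsetI)
    fix g assume "g \<in> {g \<in> carrier (Zp_Z4 p). Q g}"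
    then obtain z where "z \<in> A \<times> B" "g = ?f z" "Q g"
      using bij unfolding bij_betw_def by blast
    then show "g \<in> ?f ` {(a, b). a \<in> A \<and> b \<in> B \<and> Q (?f (a, b))}" by force
  qed (auto simp: elt_in_carrier [OF p])
  moreover have "inj_on ?f {(a, b). a \<in> A \<and> b \<in> B \<and> Q (?f (a, b))}"
    using bij unfolding bij_betw_def by (auto intro: inj_on_subset)
  ultimately show ?thesis using card_image by force
qed

text \<open>
  In the projection to \<open>\<int>\<^sub>p\<close> all sums are equally frequent, and the prime \<open>p\<close> does not divide
  \<open>card B = 4\<close>; in the projection to \<open>\<int>\<^sub>4\<close> they are equally frequent too, and \<open>2\<close> does not
  divide \<open>card A = p\<close>.
\<close>

lemma tiles_card_imp_graph:
  assumes p: "prime p" "odd p" and A: "A \<subseteq> carrier (Zp_Z4 p)" and B: "B \<subseteq> carrier (Zp_Z4 p)"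
    and t: "tiles p A B" and card: "card A = p" "card B = 4"
  obtains \<alpha> \<beta> :: "int \<Rightarrow> int" where
    "\<And>x. \<alpha> (x + int p) = \<alpha> x" "\<And>y. \<beta> (y + 4) = \<beta> y"
    "\<And>x y. elt p x y \<in> A \<longleftrightarrow> y mod 4 = \<alpha> x mod 4"
    "\<And>x y. elt p x y \<in> B \<longleftrightarrow> x mod int p = \<beta> y mod int p"
proof -
  have p0: "p > 0" using p by (simp add: prime_gt_0_nat)
  have fin: "finite A" "finite B"
    using card p0 by (auto intro: card_ge_0_finite)
  have "\<not> p dvd 4"
  proof
    assume "p dvd 4"
    then have "p dvd 2 ^ 2" by simp
    then have "p dvd 2" using p(1) prime_dvd_power by blast
    then have "p = 2" using p(1) two_is_prime_nat primes_dvd_imp_eq by blast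
    with p(2) show False by simp
  qed
  have colsA: "card {a \<in> A. fst a mod int (p ^ 1) = x mod int (p ^ 1)} = 1" for x
  proof (rule card_fibre_eq_1 [OF p(1) fin])
    show "\<not> p dvd card B" using \<open>\<not> p dvd 4\<close> card by simp
    fix x
    have "card {(a, b). a \<in> A \<and> b \<in> B \<and> (fst a + fst b) mod int (p ^ 1) = x mod int (p ^ 1)} =
      card {g \<in> carrier (Zp_Z4 p). fst g = x mod int p}"
      using tiles_card_slice [OF p0 A B t, of "\<lambda>g. fst g = x mod int p"] by simp
    also have "{g \<in> carrier (Zp_Z4 p). fst g = x mod int p} = {x mod int p} \<times> {0..<4}"
      using p0 by (auto simp: carrier_Zp_Z4)
    finally show "card {(a, b). a \<in> A \<and> b \<in> B \<and> (fst a + fst b) mod int (p ^ 1) = x mod int (p ^ 1)} = card B"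
      using card by simp
  qed
  have rowsB: "card {b \<in> B. snd b mod int (2 ^ 2) = y mod int (2 ^ 2)} = 1" for y
  proof (rule card_fibre_eq_1 [OF two_is_prime_nat fin(2,1)])
    show "\<not> 2 dvd card A" using p card by simp
    fix y
    have "card {(b, a). b \<in> B \<and> a \<in> A \<and> (snd b + snd a) mod int (2 ^ 2) = y mod int (2 ^ 2)} =
      card {g \<in> carrier (Zp_Z4 p). snd g = y mod 4}"
      using tiles_card_slice [OF p0 B A tiles_commute [OF p0 A B t], of "\<lambda>g. snd g = y mod 4"] by simp
    also have "{g \<in> carrier (Zp_Z4 p). snd g = y mod 4} = {0..<int p} \<times> {y mod 4}"
      using p0 by (auto simp: carrier_Zp_Z4)
    finally show "card {(b, a). b \<in> B \<and> a \<in> A \<and> (snd b + snd a) mod int (2 ^ 2) = y mod int (2 ^ 2)} = card A"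
      using card by (simp add: card_cartesian_product)
  qed
  have "\<forall>x. \<exists>w. {a \<in> A. fst a mod int p = x mod int p} = {w}"
    using colsA by (auto simp: card_1_singleton_iff)
  then obtain w where w: "\<And>x. {a \<in> A. fst a mod int p = x mod int p} = {w x}" by metis
  have "\<forall>y. \<exists>w. {b \<in> B. snd b mod 4 = y mod 4} = {w}"
    using rowsB by (auto simp: card_1_singleton_iff)
  then obtain v where v: "\<And>y. {b \<in> B. snd b mod 4 = y mod 4} = {v y}" by metis
  show thesis
  proof
    show "snd (w (x + int p)) = snd (w x)" for x
      using w [of x] w [of "x + int p"] by simp
    show "fst (v (y + 4)) = fst (v y)" for y
      using v [of y] v [of "y + 4"] by simp
    show "elt p x y \<in> A \<longleftrightarrow> y mod 4 = snd (w x) mod 4" for x y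
    proof -
      have "w x \<in> A" "fst (w x) mod int p = x mod int p"
        using w [of x] by blast+
      then have "w x = elt p x (snd (w x))"
        using A elt_fst_snd [OF p0] by (metis elt_mod(1) subsetD)
      moreover have "elt p x y \<in> A \<longleftrightarrow> elt p x y = w x"
        using w [of x] \<open>w x \<in> A\<close> by (metis (mono_tags, lifting) fst_elt mem_Collect_eq mod_mod_trivial singletonD)
      ultimately show ?thesis by (metis elt_eq_iff)
    qed
    show "elt p x y \<in> B \<longleftrightarrow> x mod int p = fst (v y) mod int p" for x y
    proof -
      have "v y \<in> B" "snd (v y) mod 4 = y mod 4"
        using v [of y] by blast+
      then have "v y = elt p (fst (v y)) y"
        using B elt_fst_snd [OF p0] by (metis elt_mod(2) subsetD)
      moreover have "elt p x y \<in> B \<longleftrightarrow> elt p x y = v y"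
        using v [of y] \<open>v y \<in> B\<close> by (metis (mono_tags, lifting) snd_elt mem_Collect_eq mod_mod_trivial singletonD)
      ultimately show ?thesis by (metis elt_eq_iff)
    qed
  qed
qed

text \<open>
  The element of \<open>B\<close> in row \<open>v\<close> together with the element of \<open>A\<close> in column \<open>x - \<beta> v\<close> gives the sum
  in column \<open>x\<close> with second coordinate \<open>\<alpha> (x - \<beta> v) + v\<close>.
\<close>

lemma tiles_graph_iff:
  assumes p: "p > 0" and B: "B \<subseteq> carrier (Zp_Z4 p)" and "\<And>x. \<alpha> (x + int p) = \<alpha> x"
    and mem_A: "\<And>x y. elt p x y \<in> A \<longleftrightarrow> y mod 4 = \<alpha> x mod 4"
    and mem_B: "\<And>x y. elt p x y \<in> B \<longleftrightarrow> x mod int p = \<beta> y mod int p"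
  shows "tiles p A B \<longleftrightarrow> (\<forall>x y. \<exists>!v. v \<in> {0..<4} \<and> (\<alpha> (x - \<beta> v) + v) mod 4 = y mod 4)"
proof -
  let ?f = "\<lambda>v. elt p (\<beta> v) v"
  have bij: "bij_betw ?f {0..<4} B"
  proof (rule bij_betwI [where g = snd])
    show "?f \<in> {0..<4} \<rightarrow> B" by (simp add: mem_B)
    show "snd \<in> B \<rightarrow> {0..<4}" using B p by (auto simp: carrier_Zp_Z4)
    show "?f (snd b) = b" if "b \<in> B" for b
    proof -
      have b: "b = elt p (fst b) (snd b)" using that B elt_fst_snd [OF p] by auto
      with that mem_B have "fst b mod int p = \<beta> (snd b) mod int p" by metis
      with b show ?thesis by (metis elt_eq_iff)
    qed
  qed simp
  have mem: "elt p (x - fst (?f v)) (y - snd (?f v)) \<in> A \<longleftrightarrow> (\<alpha> (x - \<beta> v) + v) mod 4 = y mod 4" for x y v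
    by (simp add: mem_A mod_eq_dvd_iff) (simp add: dvd_diff_commute algebra_simps)
  have "(\<exists>!b. b \<in> B \<and> Q b) \<longleftrightarrow> (\<exists>!v. v \<in> {0..<4} \<and> Q (?f v))" for Q
    using bij unfolding bij_betw_def inj_on_def by (smt (verit) image_iff)
  then show ?thesis by (simp only: tiles_def mem)
qed

text \<open>
  Invariance of \<open>\<beta>\<close> under the values of \<open>\<alpha>\<close> decouples the equation \<open>\<alpha> (x - \<beta> v) + v = y\<close>: it forces
  \<open>\<beta> v = \<beta> y\<close>, and then \<open>v\<close> is determined.  With \<open>\<beta>\<close>
  reduced modulo \<open>p\<close>, the condition holds in each alternative of \<open>transversal_trichotomy\<close>.
\<close>

lemma tiles_graphI:
  assumes p: "p > 0" and B: "B \<subseteq> carrier (Zp_Z4 p)" and per: "\<And>x. \<alpha> (x + int p) = \<alpha> x" "\<And>y. \<beta> (y + 4) = \<beta> y"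
    and mem_A: "\<And>x y. elt p x y \<in> A \<longleftrightarrow> y mod 4 = \<alpha> x mod 4"
    and mem_B: "\<And>x y. elt p x y \<in> B \<longleftrightarrow> x mod int p = \<beta> y mod int p"
    and inv: "\<And>x y. \<beta> (y + \<alpha> x) = \<beta> y"
  shows "tiles p A B"
  unfolding tiles_graph_iff [OF p B per(1) mem_A mem_B]
proof (intro allI)
  fix x y
  let ?v = "(y - \<alpha> (x - \<beta> y)) mod 4"
  have \<beta>_cong: "\<beta> u = \<beta> v" if "u mod 4 = v mod 4" for u v
    using per(2) that by (rule periodic_mod_cong)
  show "\<exists>!v. v \<in> {0..<4} \<and> (\<alpha> (x - \<beta> v) + v) mod 4 = y mod 4"
  proof (intro ex1I conjI)
    have "\<beta> ?v = \<beta> (y - \<alpha> (x - \<beta> y))" by (rule \<beta>_cong) simp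
    also have "\<dots> = \<beta> y" using inv [of "y - \<alpha> (x - \<beta> y)" "x - \<beta> y"] by simp
    finally show "(\<alpha> (x - \<beta> ?v) + ?v) mod 4 = y mod 4" by (simp add: mod_add_right_eq)
  next
    fix v assume v: "v \<in> {0..<4} \<and> (\<alpha> (x - \<beta> v) + v) mod 4 = y mod 4"
    then have "\<beta> y = \<beta> (v + \<alpha> (x - \<beta> v))" by (intro \<beta>_cong) (simp add: add.commute)
    then have "\<beta> y = \<beta> v" by (simp add: inv)
    with v have "v mod 4 = (y - \<alpha> (x - \<beta> y)) mod 4"
      by (metis add_diff_cancel_left' mod_diff_left_eq)
    with v show "v = ?v" by simp
  qed simp
qed

section \<open>Generating sets and factors of size two\<close>

lemma generate_leaves_difference_closed_set:
  assumes p: "p > 0" and S: "S \<subseteq> carrier (Zp_Z4 p)" and gen: "generate (Zp_Z4 p) S = carrier (Zp_Z4 p)"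
    and zero: "Q (elt p 0 0)"
    and diff: "\<And>u v. Q u \<Longrightarrow> Q v \<Longrightarrow> Q (elt p (fst u - fst v) (snd u - snd v))"
    and proper: "\<not> Q (elt p x y)"
  shows "\<exists>s\<in>S. \<not> Q s"
proof (rule ccontr)
  assume "\<not> (\<exists>s\<in>S. \<not> Q s)"
  then have S_H: "S \<subseteq> {v \<in> carrier (Zp_Z4 p). Q v}" (is "S \<subseteq> ?H") using S by blast
  interpret G: group "Zp_Z4 p" by (intro DirProd_group) simp_all
  have inv: "inv\<^bsub>Zp_Z4 p\<^esub> v = elt p (0 - fst v) (0 - snd v)" if "v \<in> carrier (Zp_Z4 p)" for v
    using that p by (cases v) (simp add: elt_def carrier_DirProd carrier_integer_mod_group)
  have mult: "u \<otimes>\<^bsub>Zp_Z4 p\<^esub> v = elt p (fst u + fst v) (snd u + snd v)" for u v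
    by (cases u; cases v) (simp add: elt_def)
  have neg: "Q (elt p (0 - fst v) (0 - snd v))" if "Q v" for v
    using diff [OF zero that] by (simp add: elt_def)
  have "subgroup ?H (Zp_Z4 p)"
  proof (rule G.subgroupI)
    show "?H \<noteq> {}" using zero elt_in_carrier [OF p] by blast
    show "inv\<^bsub>Zp_Z4 p\<^esub> v \<in> ?H" if "v \<in> ?H" for v
      using that neg elt_in_carrier [OF p] by (simp add: inv)
    show "u \<otimes>\<^bsub>Zp_Z4 p\<^esub> v \<in> ?H" if "u \<in> ?H" "v \<in> ?H" for u v
    proof -
      have "Q (elt p (fst u - fst (elt p (0 - fst v) (0 - snd v))) (snd u - snd (elt p (0 - fst v) (0 - snd v))))"
        using that by (intro diff neg) simp_all
      then show ?thesis using elt_in_carrier [OF p] by (simp add: mult)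
    qed
  qed blast
  then have "carrier (Zp_Z4 p) \<subseteq> ?H"
    using G.generate_subgroup_incl [OF S_H] gen by simp
  then show False using proper elt_in_carrier [OF p] by blast
qed

text \<open>
  Otherwise \<open>S\<close> lies in one of the two maximal subgroups \<open>0 \<times> \<int>\<^sub>4\<close> and \<open>\<int>\<^sub>p \<times> 2\<int>\<^sub>4\<close>.
\<close>

lemma generate_imp_nonzero_fst_odd_snd:
  assumes p: "p > 1" and S: "S \<subseteq> carrier (Zp_Z4 p)" and gen: "generate (Zp_Z4 p) S = carrier (Zp_Z4 p)"
  shows "\<exists>s\<in>S. fst s \<noteq> 0" and "\<exists>s\<in>S. odd (snd s)"
proof -
  have p0: "p > 0" using p by simp
  show "\<exists>s\<in>S. fst s \<noteq> 0"
    by (rule generate_leaves_difference_closed_set [OF p0 S gen, where x = 1 and y = 0]) (use p in simp_all)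
  show "\<exists>s\<in>S. odd (snd s)"
    by (rule generate_leaves_difference_closed_set [OF p0 S gen, where x = 0 and y = 1])
      (simp_all add: even_mod_4 [symmetric])
qed

text \<open>
  The indicator function \<open>P\<close> flips under translation by \<open>(a, b)\<close>, so it is invariant under
  \<open>(2 * a, 2 * b)\<close>.  The cases are named after the order of \<open>(a, b)\<close>; the odd orders \<open>1\<close> and \<open>p\<close> are
  impossible, because an odd number of flips would be the identity.  When \<open>p\<close> does not
  divide \<open>a\<close>, the element \<open>(4 * a, 4 * b)\<close> generates \<open>\<int>\<^sub>p \<times> 0\<close>, so \<open>P\<close> does not depend on the first
  coordinate.
\<close>

lemma alternating_function_cases:
  fixes P :: "int \<Rightarrow> int \<Rightarrow> bool" and p :: nat and a b :: int
  assumes p: "prime p" "odd p"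
    and perx: "\<And>x y. P (x + int p) y \<longleftrightarrow> P x y" and pery: "\<And>x y. P x (y + 4) \<longleftrightarrow> P x y"
    and P0: "P 0 0" and alt: "\<And>x y. P x y \<longleftrightarrow> \<not> P (x - a) (y - b)"
  obtains
    (generator) "\<not> int p dvd a" "odd b" "\<And>x y. P x y \<longleftrightarrow> even y"
  | (order_4) "int p dvd a" "odd b" "\<And>x y. P x y \<longleftrightarrow> (even y \<longleftrightarrow> P x 0)"
  | (order_2) "int p dvd a" "b mod 4 = 2" "\<And>x y. P x (y + 2) \<longleftrightarrow> \<not> P x y"
  | (order_2p) "\<not> int p dvd a" "b mod 4 = 2" "\<And>x y. P x y \<longleftrightarrow> P 0 y" "\<And>x y. P x (y + 2) \<longleftrightarrow> \<not> P x y"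
proof -
  have xcong: "P x y \<longleftrightarrow> P x' y" if "x mod int p = x' mod int p" for x x' y
    using periodic_mod_cong [of "\<lambda>x. P x y", OF perx that] .
  have ycong: "P x y \<longleftrightarrow> P x y'" if "y mod 4 = y' mod 4" for x y y'
    using periodic_mod_cong [of "P x", OF pery that] .
  have step: "P (x + a) (y + b) \<longleftrightarrow> \<not> P x y" for x y
    using alt [of "x + a" "y + b"] by simp
  have step2: "P (x + 2 * a) (y + 2 * b) \<longleftrightarrow> P x y" for x y
    using step [of "x + a" "y + b"] step [of x y] by (simp add: algebra_simps)
  have xconst: "P x y \<longleftrightarrow> P 0 y" if "\<And>x. P (x + d) y \<longleftrightarrow> P x y" "coprime d (int p)" for d x y
    using invariant_imp_constant [of "\<lambda>x. P x y", OF perx that] .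
  have nondvd: "coprime (k * a) (int p)" if "\<not> int p dvd a" "k = 1 \<or> k = 2 \<or> k = 4" for k
  proof -
    have "coprime a (int p)" using prime_imp_coprime [of "int p" a] that(1) p(1) by (simp add: coprime_commute)
    moreover have "coprime 2 (int p)" using p(2) by simp
    then have "coprime 4 (int p)" using coprime_power_left_iff [of 2 2 "int p"] by simp
    ultimately show ?thesis using that(2) \<open>coprime 2 (int p)\<close> by auto
  qed
  have dvd_step: "P x (y + b) \<longleftrightarrow> \<not> P x y" if "int p dvd a" for x y
  proof -
    have "(x + a) mod int p = x mod int p" using that by (simp add: mod_eq_dvd_iff)
    then show ?thesis using step [of x y] xcong by blast
  qed
  have parity: "P x y \<longleftrightarrow> (even y \<longleftrightarrow> P x 0)"
    if "odd b" "\<And>y. P x (y + b) \<longleftrightarrow> \<not> P x y" for x y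
  proof -
    have twice: "P x (y + 2) \<longleftrightarrow> P x y" for y
    proof -
      have "P x (y + b + b) \<longleftrightarrow> P x y" using that(2) [of "y + b"] that(2) [of y] by simp
      moreover obtain m where "b = 2 * m + 1" using \<open>odd b\<close> by (rule oddE)
      then have "(y + b + b) mod 4 = (y + 2) mod 4" by (simp add: mod_eq_dvd_iff)
      ultimately show ?thesis using ycong by blast
    qed
    have two: "P x y \<longleftrightarrow> P x y'" if "y mod 2 = y' mod 2" for y y'
      using periodic_mod_cong [of "P x", OF twice that] .
    show ?thesis
    proof (cases "even y")
      case True
      then show ?thesis using two [of y 0] by simp
    next
      case False
      then have "y mod 2 = (0 + b) mod 2" using that(1) by (simp add: odd_iff_mod_2_eq_one)
      then show ?thesis using two [of y "0 + b"] that(2) [of 0] False by simp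
    qed
  qed
  show thesis
  proof (cases "int p dvd a")
    case True
    show thesis
    proof (cases "odd b")
      case odd: True
      show thesis using True odd parity [OF odd dvd_step [OF True]] by (rule order_4)
    next
      case False
      have "b mod 4 \<noteq> 0"
        using dvd_step [OF True, of 0 0] ycong [of b 0 0] by auto
      with False have b: "b mod 4 = 2" by presburger
      have "P x (y + 2) \<longleftrightarrow> \<not> P x y" for x y
      proof -
        have "(y + b) mod 4 = (y + 2) mod 4" by (rule mod_add_cong) (simp_all add: b)
        then have "P x (y + b) \<longleftrightarrow> P x (y + 2)" by (rule ycong)
        with dvd_step [OF True, of x y] show ?thesis by simp
      qed
      with True b show thesis by (rule order_2)
    qed
  next
    case False
    have "P (x + 4 * a) y \<longleftrightarrow> P x y" for x y
    proof -
      have "P (x + 2 * a + 2 * a) (y + 2 * b + 2 * b) \<longleftrightarrow> P x y"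
        using step2 [of "x + 2 * a" "y + 2 * b"] step2 [of x y] by simp
      moreover have "(y + 2 * b + 2 * b) mod 4 = y mod 4" by (simp add: mod_eq_dvd_iff)
      moreover have "x + 2 * a + 2 * a = x + 4 * a" by simp
      ultimately show ?thesis using ycong [of "y + 2 * b + 2 * b" y "x + 4 * a"] by simp
    qed
    then have indep: "P x y \<longleftrightarrow> P 0 y" for x y
      by (rule xconst) (rule nondvd [OF False], simp)
    have step0: "P x (y + b) \<longleftrightarrow> \<not> P x y" for x y
      using step [of x y] indep [of "x + a" "y + b"] indep [of x y] indep [of x "y + b"] by simp
    show thesis
    proof (cases "odd b")
      case odd: True
      have "P x y \<longleftrightarrow> even y" for x y
        using parity [OF odd step0, of x y] indep [of x 0] P0 by simp
      with False odd show thesis by (rule generator)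
    next
      case even: False
      have "b mod 4 \<noteq> 0"
        using step0 [of 0 0] ycong [of b 0 0] by auto
      with even have b: "b mod 4 = 2" by presburger
      have "P x (y + 2) \<longleftrightarrow> \<not> P x y" for x y
      proof -
        have "(y + b) mod 4 = (y + 2) mod 4" by (rule mod_add_cong) (simp_all add: b)
        then have "P x (y + b) \<longleftrightarrow> P x (y + 2)" by (rule ycong)
        with step0 [of x y] show ?thesis by simp
      qed
      with False b indep show thesis by (rule order_2p)
    qed
  qed
qed

text \<open>
  A subset of \<open>\<int>\<^sub>4\<close> whose indicator function flips under adding \<open>2\<close> picks one element from each
  parity class: either \<open>y mod 2\<close> or \<open>y mod 2 + 2\<close>.
\<close>

lemma half_turn_iff:
  fixes Q :: "int \<Rightarrow> bool"
  assumes "\<And>y. Q (y + 4) \<longleftrightarrow> Q y" "\<And>y. Q (y + 2) \<longleftrightarrow> \<not> Q y"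
  shows "Q y \<longleftrightarrow> y mod 4 = (y mod 2 + 2 * (if Q (y mod 2) then 0 else 1)) mod 4"
proof -
  have cong: "Q y \<longleftrightarrow> Q y'" if "y mod 4 = y' mod 4" for y'
    using periodic_mod_cong [of Q, OF assms(1) that] .
  define r where "r = y mod 2"
  have r: "r = y mod 4 mod 2" by (simp add: r_def mod_mod_cancel)
  have near: "y mod 4 = r mod 4 \<or> y mod 4 = (r + 2) mod 4"
    unfolding r by (cases y rule: mod_4_cases) simp_all
  have far: "r mod 4 \<noteq> (r + 2) mod 4"
    by (simp add: mod_eq_dvd_iff)
  have "Q y \<longleftrightarrow> y mod 4 = (r + 2 * (if Q r then 0 else 1)) mod 4"
    using near
  proof
    assume *: "y mod 4 = r mod 4"
    have "Q y \<longleftrightarrow> Q r" by (rule cong [OF *])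
    then show ?thesis using * far by (cases "Q r") simp_all
  next
    assume *: "y mod 4 = (r + 2) mod 4"
    have "Q y \<longleftrightarrow> \<not> Q r" using cong [OF *] assms(2) [of r] by (rule trans)
    then show ?thesis using * far by (cases "Q r") simp_all
  qed
  then show ?thesis by (simp only: r_def)
qed

lemma half_turn_alternates:
  "(y + 2) mod 4 = ((y + 2) mod 2 + 2 * f (nat ((y + 2) mod 2))) mod 4 \<longleftrightarrow>
    y mod 4 \<noteq> (y mod 2 + 2 * f (nat (y mod 2))) mod (4 :: int)"
proof -
  have "(y + 2) mod 4 = (y mod 2 + 2 * k) mod 4 \<longleftrightarrow> y mod 4 \<noteq> (y mod 2 + 2 * k) mod 4" for k
  proof -
    define n where "n = y div 2 - k"
    have "y - (y mod 2 + 2 * k) = 2 * n" "y + 2 - (y mod 2 + 2 * k) = 2 * n + 2"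
      by (simp_all add: n_def minus_mod_eq_mult_div [symmetric] algebra_simps)
    moreover have "4 dvd 2 * n + 2 \<longleftrightarrow> \<not> 4 dvd 2 * n" by presburger
    ultimately show ?thesis by (simp only: mod_eq_dvd_iff)
  qed
  then show ?thesis by simp
qed

text \<open>
  The first coordinate \<open>c\<close> may be changed by multiples of \<open>p\<close>; as \<open>p\<close> is odd, this adjusts the parity
  of \<open>c\<close> and thus \<open>1 + 2 * c\<close> modulo \<open>4\<close>.  So one parameter describes all elements with an odd
  second coordinate.
\<close>

lemma crt_odd:
  fixes a b :: int
  assumes "odd (p :: nat)" "odd b"
  obtains c where "c mod int p = a mod int p" "(1 + 2 * c) mod 4 = b mod 4"
proof
  \<comment> \<open>Modulo \<open>2\<close> this is \<open>a + (a + (b - 1) div 2)\<close>, that is, \<open>(b - 1) div 2\<close>.\<close>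
  let ?c = "a + int p * (a + (b - 1) div 2)"
  show "?c mod int p = a mod int p" by simp
  obtain k where k: "int p = 2 * k + 1" using assms(1) by (metis even_of_nat oddE)
  obtain m where m: "b = 2 * m + 1" using assms(2) by (rule oddE)
  have "1 + 2 * ?c - b = 4 * (a + k * (a + m))" by (simp add: k m algebra_simps)
  then have "4 dvd 1 + 2 * ?c - b" by (simp only: dvd_triv_left)
  then show "(1 + 2 * ?c) mod 4 = b mod 4" by (simp only: mod_eq_dvd_iff)
qed

section \<open>Membership in the parametrized families\<close>

text \<open>
  Each family indexes its elements by residues.  Membership of \<open>elt p x y\<close> fixes the index, which
  turns the description by parameters into a condition on \<open>x\<close> and \<open>y\<close>.
\<close>

lemma ex_residue_iff: "m > 0 \<Longrightarrow> (\<exists>i\<in>{0..<m}. x mod int m = int i mod int m \<and> Q i) \<longleftrightarrow> Q (nat (x mod int m))"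
proof -
  assume "m > 0"
  then have "x mod int m = int i mod int m \<longleftrightarrow> i = nat (x mod int m)" if "i \<in> {0..<m}" for i
    using that by auto
  moreover have "nat (x mod int m) \<in> {0..<m}" using \<open>m > 0\<close> by (simp add: nat_less_iff)
  ultimately show ?thesis by metis
qed

lemma elt_column_iff:
  "p > 0 \<Longrightarrow> elt p x y \<in> {elt p (int i) (g i) | i. i \<in> {0..<p}} \<longleftrightarrow>
    y mod 4 = g (nat (x mod int p)) mod 4"
  unfolding mem_elt_image_iff by (rule ex_residue_iff)

lemma elt_row_iff:
  "elt p x y \<in> {elt p (f i) (int i) | i. i \<in> {0..<4}} \<longleftrightarrow>
    x mod int p = f (nat (y mod 4)) mod int p"
proof -
  have "(\<exists>i\<in>{0..<4}. y mod 4 = int i mod 4 \<and> x mod int p = f i mod int p) \<longleftrightarrow>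
    x mod int p = f (nat (y mod 4)) mod int p"
    using ex_residue_iff [of 4 y "\<lambda>i. x mod int p = f i mod int p"] by (simp only: of_nat_numeral zero_less_numeral simp_thms)
  then show ?thesis unfolding mem_elt_image_iff by (simp only: conj_commute)
qed

lemma ex_two_mod_4: "(\<exists>j\<in>{0..<2::nat}. y mod 4 = (c + 2 * int j) mod 4) \<longleftrightarrow> even (y - c)"
proof -
  have "{0..<2::nat} = {0, 1}" by auto
  moreover have "y mod 4 = c mod 4 \<or> y mod 4 = (c + 2) mod 4 \<longleftrightarrow> even (y - c)"
  proof -
    have "4 dvd z \<or> 4 dvd z - 2 \<longleftrightarrow> even z" for z :: int by presburger
    moreover have "y - (c + 2) = y - c - 2" by simp
    ultimately show ?thesis by (simp only: mod_eq_dvd_iff)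
  qed
  ultimately show ?thesis by simp
qed

lemma bex_conj_distrib: "(\<exists>j\<in>J. Q \<and> R j) \<longleftrightarrow> Q \<and> (\<exists>j\<in>J. R j)"
  by blast

lemma elt_even_column_iff:
  assumes "p > 0"
  shows "elt p x y \<in> {elt p (int i) (g i + 2 * int j) | i j. i \<in> {0..<p} \<and> j \<in> {0..<2}} \<longleftrightarrow>
    even (y - g (nat (x mod int p)))"
  unfolding mem_elt_image2_iff bex_conj_distrib ex_two_mod_4 by (rule ex_residue_iff [OF assms])

lemma ex_nat_less_2_parity: "(\<exists>i\<in>{0..<2::nat}. even (y - int i) \<and> Q i) \<longleftrightarrow> Q (nat (y mod 2))"
proof -
  have "{0..<2::nat} = {0, 1}" by auto
  then have "(\<exists>i\<in>{0..<2::nat}. even (y - int i) \<and> Q i) \<longleftrightarrow> even y \<and> Q 0 \<or> odd y \<and> Q 1"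
    by simp
  also have "\<dots> \<longleftrightarrow> Q (nat (y mod 2))"
  proof (cases "even y")
    case True
    then have "nat (y mod 2) = 0" by simp
    with True show ?thesis by simp
  next
    case False
    then have "nat (y mod 2) = 1" by (simp add: odd_iff_mod_2_eq_one)
    with False show ?thesis by (simp only: simp_thms)
  qed
  finally show ?thesis .
qed

lemma elt_parity_row_iff:
  "elt p x y \<in> {elt p (f i) (int i + 2 * int j) | i j. i \<in> {0..<2} \<and> j \<in> {0..<2}} \<longleftrightarrow>
    x mod int p = f (nat (y mod 2)) mod int p"
  unfolding mem_elt_image2_iff bex_conj_distrib ex_two_mod_4
  using ex_nat_less_2_parity [of y "\<lambda>i. x mod int p = f i mod int p"] by (simp only: conj_commute)

lemma ex_parity_mod_4:
  "(\<exists>j\<in>{0..<2::nat}. y mod 4 = (int j + 2 * f j) mod 4) \<longleftrightarrow>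
    y mod 4 = (y mod 2 + 2 * f (nat (y mod 2))) mod 4"
proof -
  have "even (y - int j)" if "y mod 4 = (int j + 2 * f j) mod 4" for j
  proof -
    have "4 dvd (y - int j) - 2 * f j" using that by (simp add: mod_eq_dvd_iff algebra_simps)
    then have "2 dvd (y - int j) - 2 * f j" by (rule dvd_trans [rotated]) simp
    then show ?thesis by simp
  qed
  then have "(\<exists>j\<in>{0..<2::nat}. y mod 4 = (int j + 2 * f j) mod 4) \<longleftrightarrow>
    (\<exists>j\<in>{0..<2::nat}. even (y - int j) \<and> y mod 4 = (int j + 2 * f j) mod 4)"
    by (intro bex_cong refl) metis
  also have "\<dots> \<longleftrightarrow> y mod 4 = (int (nat (y mod 2)) + 2 * f (nat (y mod 2))) mod 4"
    by (rule ex_nat_less_2_parity)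
  also have "int (nat (y mod 2)) = y mod 2" by simp
  finally show ?thesis .
qed

lemma elt_half_turn_columns_iff:
  assumes "p > 0"
  shows "elt p x y \<in> {elt p (int i) (int j + 2 * f i j) | i j. i \<in> {0..<p} \<and> j \<in> {0..<2}} \<longleftrightarrow>
    y mod 4 = (y mod 2 + 2 * f (nat (x mod int p)) (nat (y mod 2))) mod 4"
  unfolding mem_elt_image2_iff bex_conj_distrib ex_parity_mod_4 by (rule ex_residue_iff [OF assms])

lemma elt_half_turn_rows_iff:
  assumes "p > 0"
  shows "elt p x y \<in> {elt p (int j) (int i + 2 * f i) | i j. i \<in> {0..<2} \<and> j \<in> {0..<p}} \<longleftrightarrow>
    y mod 4 = (y mod 2 + 2 * f (nat (y mod 2))) mod 4"
proof -
  have "{elt p (int j) (int i + 2 * f i) | i j. i \<in> {0..<2} \<and> j \<in> {0..<p}} =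
    {elt p (int j) (int i + 2 * f i) | j i. j \<in> {0..<p} \<and> i \<in> {0..<2}}" by blast
  then show ?thesis by (simp only: elt_half_turn_columns_iff [OF assms])
qed

lemma Collect_less_2: "{h i | i. i \<in> {0..<2::nat}} = {h 0, h 1}"
proof -
  have "{0..<2::nat} = {0, 1}" by auto
  then show ?thesis by auto
qed

section \<open>The listed pairs are tilings\<close>

lemma elt_image_subset:
  assumes "p > 0"
  shows "{elt p (f i) (g i) | i. i \<in> I} \<subseteq> carrier (Zp_Z4 p)"
    and "{elt p (f' i j) (g' i j) | i j. i \<in> I \<and> j \<in> J} \<subseteq> carrier (Zp_Z4 p)"
  using elt_in_carrier [OF assms] by blast+

lemma elt_odd_neq: "odd b \<Longrightarrow> elt p a b \<noteq> elt p 0 0"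
  by (auto simp: elt_eq_iff even_mod_4 [of b])

lemma generator_pair_tiles:
  assumes p: "p > 0" and "\<alpha> 0 = 0"
  shows "tiles p {elt p (\<alpha> i) (int i + 2 * \<alpha> i) | i. i \<in> {0..<2}}
    {elt p (int i) (2 * int j) | i j. i \<in> {0..<p} \<and> j \<in> {0..<2}}" (is "tiles p ?A ?B")
proof -
  have A: "?A = {elt p 0 0, elt p (\<alpha> 1) (1 + 2 * \<alpha> 1)}"
    unfolding Collect_less_2 using assms(2) by simp
  have B: "elt p x y \<in> ?B \<longleftrightarrow> even y" for x y
    using elt_even_column_iff [OF p, of x y "\<lambda>_. 0"] by (simp only: add_0 diff_zero)
  have neq: "elt p (\<alpha> 1) (1 + 2 * \<alpha> 1) \<noteq> elt p 0 0"
    by (rule elt_odd_neq) simp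
  have "tiles p ?B ?A"
    unfolding A tiles_pair_iff [OF neq] B by simp
  then show ?thesis
    by (rule tiles_commute [OF p elt_image_subset(2) [OF p] elt_image_subset(1) [OF p]])
qed

lemma column_graph_tiles:
  assumes p: "p > 0"
  shows "tiles p {elt p (int i) (\<alpha> i) | i. i \<in> {0..<p}} {elt p 0 (int i) | i. i \<in> {0..<4}}"
    (is "tiles p ?A ?B")
proof (rule tiles_graphI [OF p, where \<alpha> = "\<lambda>x. \<alpha> (nat (x mod int p))" and \<beta> = "\<lambda>_. 0"])
  show "?B \<subseteq> carrier (Zp_Z4 p)" by (rule elt_image_subset [OF p])
  show "elt p x y \<in> ?A \<longleftrightarrow> y mod 4 = \<alpha> (nat (x mod int p)) mod 4" for x y
    by (rule elt_column_iff [OF p])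
  show "elt p x y \<in> ?B \<longleftrightarrow> x mod int p = 0 mod int p" for x y
    by (rule elt_row_iff)
qed (simp_all only: mod_add_self2)

lemma even_columns_tile:
  assumes p: "p > 0" and "l 0 = 0"
  shows "tiles p {elt p (int i) (\<alpha> i + 2 * int j) | i j. i \<in> {0..<p} \<and> j \<in> {0..<2}}
    {elt p 0 (int i + 2 * l i) | i. i \<in> {0..<2}}" (is "tiles p ?A ?B")
proof -
  have B: "?B = {elt p 0 0, elt p 0 (1 + 2 * l 1)}"
    unfolding Collect_less_2 using assms(2) by simp
  have neq: "elt p 0 (1 + 2 * l 1) \<noteq> elt p 0 0"
    by (rule elt_odd_neq) simp
  show ?thesis
    unfolding B tiles_pair_iff [OF neq] elt_even_column_iff [OF p] diff_zero by simp
qed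

lemma half_turn_alternates':
  "y mod 4 = (y mod 2 + 2 * f (nat (y mod 2))) mod 4 \<longleftrightarrow>
    (y - 2) mod 4 \<noteq> ((y - 2) mod 2 + 2 * f (nat ((y - 2) mod 2))) mod (4 :: int)"
  using half_turn_alternates [of "y - 2" f] by (simp only: diff_add_cancel)

lemma elt_0_2_neq: "elt p x 2 \<noteq> elt p 0 0"
  by (simp add: elt_eq_iff)

lemma half_turn_rows_tile:
  assumes p: "p > 0" and "l 0 = 0"
  shows "tiles p {elt p (int j) (int i + 2 * \<alpha> i) | i j. i \<in> {0..<2} \<and> j \<in> {0..<p}}
    {elt p (l i) (2 * int i) | i. i \<in> {0..<2}}" (is "tiles p ?A ?B")
proof -
  have B: "?B = {elt p 0 0, elt p (l 1) 2}"
    unfolding Collect_less_2 using assms(2) by simp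
  show ?thesis
    unfolding B tiles_pair_iff [OF elt_0_2_neq] elt_half_turn_rows_iff [OF p]
    by (intro allI) (rule half_turn_alternates')
qed

lemma half_turn_columns_tile:
  assumes p: "p > 0"
  shows "tiles p {elt p (int i) (int j + 2 * \<alpha> i j) | i j. i \<in> {0..<p} \<and> j \<in> {0..<2}}
    {elt p 0 (2 * int i) | i. i \<in> {0..<2}}" (is "tiles p ?A ?B")
proof -
  have B: "?B = {elt p 0 0, elt p 0 2}"
    unfolding Collect_less_2 by simp
  show ?thesis
    unfolding B tiles_pair_iff [OF elt_0_2_neq] elt_half_turn_columns_iff [OF p] diff_zero
    by (intro allI) (rule half_turn_alternates')
qed

lemma parity_rows_tile:
  assumes p: "p > 0"
  shows "tiles p {elt p (\<alpha> i) (int i + 2 * int j) | i j. i \<in> {0..<2} \<and> j \<in> {0..<2}}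
    {elt p (int i) (2 * l i) | i. i \<in> {0..<p}}" (is "tiles p ?A ?B")
proof -
  have "tiles p ?B ?A"
  proof (rule tiles_graphI [OF p, where \<alpha> = "\<lambda>x. 2 * l (nat (x mod int p))" and \<beta> = "\<lambda>y. \<alpha> (nat (y mod 2))"])
    show "?A \<subseteq> carrier (Zp_Z4 p)" by (rule elt_image_subset [OF p])
    show "elt p x y \<in> ?B \<longleftrightarrow> y mod 4 = 2 * l (nat (x mod int p)) mod 4" for x y
      by (rule elt_column_iff [OF p])
    show "elt p x y \<in> ?A \<longleftrightarrow> x mod int p = \<alpha> (nat (y mod 2)) mod int p" for x y
      by (rule elt_parity_row_iff)
    show "\<alpha> (nat ((y + 4) mod 2)) = \<alpha> (nat (y mod 2))" for y :: int
    proof -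
      have "(y + 4) mod 2 = y mod 2" by presburger
      then show ?thesis by (simp only:)
    qed
  qed (simp_all only: mod_add_self2 mod_mult_self2)
  then show ?thesis
    by (rule tiles_commute [OF p elt_image_subset(1) [OF p] elt_image_subset(2) [OF p]])
qed

lemma row_graph_tiles:
  assumes p: "p > 0"
  shows "tiles p {elt p (\<alpha> i) (int i) | i. i \<in> {0..<4}} {elt p (int i) 0 | i. i \<in> {0..<p}}"
    (is "tiles p ?A ?B")
proof -
  have "tiles p ?B ?A"
  proof (rule tiles_graphI [OF p, where \<alpha> = "\<lambda>_. 0" and \<beta> = "\<lambda>y. \<alpha> (nat (y mod 4))"])
    show "?A \<subseteq> carrier (Zp_Z4 p)" by (rule elt_image_subset [OF p])
    show "elt p x y \<in> ?B \<longleftrightarrow> y mod 4 = 0 mod 4" for x y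
      by (rule elt_column_iff [OF p])
    show "elt p x y \<in> ?A \<longleftrightarrow> x mod int p = \<alpha> (nat (y mod 4)) mod int p" for x y
      by (rule elt_row_iff)
  qed (simp_all only: mod_add_self2 add_0_right)
  then show ?thesis
    by (rule tiles_commute [OF p elt_image_subset(1) [OF p] elt_image_subset(1) [OF p]])
qed

section \<open>Every tiling is listed\<close>

lemma factorization_4p:
  fixes m n p :: nat
  assumes "prime p" and mn: "m * n = 4 * p"
  shows "m = 1 \<or> m = 2 \<or> m = 4 \<and> n = p \<or> m = p \<and> n = 4 \<or> n = 2 \<or> m = 4 * p"
proof -
  have p0: "p > 0" using assms(1) by (rule prime_gt_0_nat)
  have div4: "k = 1 \<and> l = 4 \<or> k = 2 \<and> l = 2 \<or> k = 4 \<and> l = 1" if "k * l = 4" for k l :: nat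
  proof -
    have "k dvd 4" using that by (metis dvd_triv_left)
    then have "k \<le> 4" by (rule dvd_imp_le) simp
    moreover have "k \<noteq> 0" using that by (cases k) simp_all
    ultimately have "k = 1 \<or> k = 2 \<or> k = 3 \<or> k = 4" by linarith
    then show ?thesis using that by (elim disjE) (simp_all, presburger?)
  qed
  have "p dvd m * n" using mn by simp
  then consider k where "m = p * k" | k where "n = p * k"
    using assms(1) by (auto simp: prime_dvd_mult_iff elim!: dvdE)
  then show ?thesis
  proof cases
    case 1
    then have "k * n = 4" using mn p0 by simp
    with 1 show ?thesis by (auto dest: div4)
  next
    case 2
    then have "m * k = 4" using mn p0 by simp
    with 2 show ?thesis by (auto dest: div4)
  qed
qed

lemma pair_containing_0:
  assumes p: "p > 0" and "A \<subseteq> carrier (Zp_Z4 p)" "elt p 0 0 \<in> A" "card A = 2"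
  obtains a b where "A = {elt p 0 0, elt p a b}" "elt p a b \<noteq> elt p 0 0"
proof -
  obtain d where d: "A = {elt p 0 0, d}" "d \<noteq> elt p 0 0"
    using assms(3,4) unfolding card_2_iff by fastforce
  moreover have "d = elt p (fst d) (snd d)"
    using elt_fst_snd [OF p, of d] assms(2) d(1) by simp
  ultimately show thesis using that by metis
qed

text \<open>
  The functions are normalized to reduced values, with \<open>\<alpha> 0 = 0\<close> and \<open>\<beta> 0 = 0\<close> on the nose, as the
  parameters of the families are.
\<close>

lemma tiles_4_p_structure:
  assumes p: "prime p" "odd p" and A: "A \<subseteq> carrier (Zp_Z4 p)" and B: "B \<subseteq> carrier (Zp_Z4 p)"
    and t: "tiles p A B" and card: "card A = p" "card B = 4" and zero: "elt p 0 0 \<in> A" "elt p 0 0 \<in> B"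
  obtains \<alpha> \<beta> :: "int \<Rightarrow> int" where
    "\<alpha> 0 = 0" "\<beta> 0 = 0"
    "\<And>x y. elt p x y \<in> A \<longleftrightarrow> y mod 4 = \<alpha> (x mod int p) mod 4"
    "\<And>x y. elt p x y \<in> B \<longleftrightarrow> x mod int p = \<beta> (y mod 4) mod int p"
    "(\<forall>x. \<alpha> x mod 4 = 0) \<or>
      (\<forall>x. even (\<alpha> x)) \<and> \<beta> 2 mod int p = 0 \<and> \<beta> 3 mod int p = \<beta> 1 mod int p \<or>
      (\<forall>j\<in>{0..<4}. \<beta> j mod int p = 0)"
proof -
  have p0: "p > 0" using p by (simp add: prime_gt_0_nat)
  obtain \<alpha> \<beta> where per: "\<And>x. \<alpha> (x + int p) = \<alpha> x" "\<And>y. \<beta> (y + 4) = \<beta> y"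
    and memA: "\<And>x y. elt p x y \<in> A \<longleftrightarrow> y mod 4 = \<alpha> x mod 4"
    and memB: "\<And>x y. elt p x y \<in> B \<longleftrightarrow> x mod int p = \<beta> y mod int p"
    using tiles_card_imp_graph [OF p A B t card] by blast
  have unique: "\<exists>!v. v \<in> {0..<4} \<and> (\<alpha> (x - \<beta> v) + v) mod 4 = y mod 4" for x y
    using t tiles_graph_iff [OF p0 B per(1) memA memB] by blast
  have cases: "(\<forall>x. \<alpha> x mod 4 = 0) \<or>
    (\<forall>x. even (\<alpha> x)) \<and> \<beta> 2 mod int p = 0 \<and> \<beta> 3 mod int p = \<beta> 1 mod int p \<or>
    (\<forall>j\<in>{0..<4}. \<beta> j mod int p = 0)"
  proof (rule transversal_trichotomy [where \<alpha> = \<alpha> and \<beta> = \<beta>, OF p(1) per(1)])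
    show "\<alpha> 0 mod 4 = 0" "\<beta> 0 mod int p = 0"
      using zero memA memB by (metis mod_0)+
    show "(\<alpha> (x - \<beta> j) + j) mod 4 \<noteq> (\<alpha> (x - \<beta> k) + k) mod 4"
      if "j \<in> {0..<4}" "k \<in> {0..<4}" "j \<noteq> k" for x j k
      using that unique [of x "\<alpha> (x - \<beta> j) + j"] by metis
  qed
  define \<alpha>' where "\<alpha>' x = \<alpha> x mod 4" for x
  define \<beta>' where "\<beta>' y = \<beta> y mod int p" for y
  show thesis
  proof
    show "\<alpha>' 0 = 0" "\<beta>' 0 = 0"
      unfolding \<alpha>'_def \<beta>'_def using zero memA memB by (metis mod_0)+
    show "elt p x y \<in> A \<longleftrightarrow> y mod 4 = \<alpha>' (x mod int p) mod 4" for x y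
      using memA [of "x mod int p" y] by (simp add: \<alpha>'_def)
    show "elt p x y \<in> B \<longleftrightarrow> x mod int p = \<beta>' (y mod 4) mod int p" for x y
      using memB [of x "y mod 4"] by (simp add: \<beta>'_def)
    have "even (\<alpha>' x) \<longleftrightarrow> even (\<alpha> x)" for x
      unfolding \<alpha>'_def by (rule even_mod_4 [symmetric])
    with cases show "(\<forall>x. \<alpha>' x mod 4 = 0) \<or>
      (\<forall>x. even (\<alpha>' x)) \<and> \<beta>' 2 mod int p = 0 \<and> \<beta>' 3 mod int p = \<beta>' 1 mod int p \<or>
      (\<forall>j\<in>{0..<4}. \<beta>' j mod int p = 0)"
      by (simp add: \<alpha>'_def \<beta>'_def)
  qed
qed

text \<open>
  Here \<open>(a, b)\<close> generates the whole group, so \<open>C\<close> is the subgroup of index two.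
\<close>

lemma tiles_pair_left_imp:
  assumes p: "prime p" "odd p" and C: "C \<subseteq> carrier (Zp_Z4 p)" "elt p 0 0 \<in> C"
    and t: "tiles p {elt p 0 0, elt p a b} C" and ab: "a mod int p \<noteq> 0" "odd b"
  shows "\<exists>\<alpha> :: nat \<Rightarrow> int. \<alpha> 0 = 0 \<and>
       {elt p 0 0, elt p a b} = {elt p (\<alpha> i) (int i + 2 * \<alpha> i) | i. i \<in> {0..<2}} \<and>
       C = {elt p (int i) (2 * int j) | i j. i \<in> {0..<p} \<and> j \<in> {0..<2}}"
proof -
  have p0: "p > 0" using p by (simp add: prime_gt_0_nat)
  have "tiles p C {elt p 0 0, elt p a b}"
    by (rule tiles_commute [OF p0 _ C(1) t]) (use elt_in_carrier [OF p0] in blast)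
  then have alt: "elt p x y \<in> C \<longleftrightarrow> elt p (x - a) (y - b) \<notin> C" for x y
    unfolding tiles_pair_iff [OF elt_odd_neq [OF ab(2)]] by blast
  have even: "elt p x y \<in> C \<longleftrightarrow> even y" for x y
  proof (rule alternating_function_cases [of p "\<lambda>x y. elt p x y \<in> C" a b, OF p _ _ C(2) alt])
    show "elt p (u + int p) v \<in> C \<longleftrightarrow> elt p u v \<in> C" "elt p u (v + 4) \<in> C \<longleftrightarrow> elt p u v \<in> C" for u v
      by (simp_all only: elt_periodic)
  next
    assume *: "\<And>x y. elt p x y \<in> C \<longleftrightarrow> even y"
    show ?thesis by (rule *)
  next
    assume "int p dvd a"
    with ab(1) show ?thesis by (simp only: dvd_eq_mod_eq_0)
  next
    assume "int p dvd a"
    with ab(1) show ?thesis by (simp only: dvd_eq_mod_eq_0)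
  next
    assume "b mod 4 = 2"
    then have "even (b mod 4)" by (simp only: even_numeral)
    with ab(2) show ?thesis by (simp only: even_mod_4 [symmetric])
  qed
  have "C = {elt p (int i) (2 * int j) | i j. i \<in> {0..<p} \<and> j \<in> {0..<2}}" (is "C = ?C")
  proof (rule subset_carrier_eqI [OF p0 C(1)])
    show "?C \<subseteq> carrier (Zp_Z4 p)" by (rule elt_image_subset [OF p0])
    show "elt p x y \<in> C \<longleftrightarrow> elt p x y \<in> ?C" for x y
      using elt_even_column_iff [OF p0, of x y "\<lambda>_. 0"] by (simp only: even add_0 diff_zero)
  qed
  moreover obtain c where "c mod int p = a mod int p" "(1 + 2 * c) mod 4 = b mod 4"
    using crt_odd [OF p(2) ab(2)] by blast
  then have c: "elt p a b = elt p c (1 + 2 * c)" by (simp only: elt_eq_iff)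
  have "{elt p 0 0, elt p a b} = {elt p (\<alpha> i) (int i + 2 * \<alpha> i) | i. i \<in> {0..<2}}"
    if "\<alpha> = (\<lambda>i. if i = 0 then 0 else c)" for \<alpha> :: "nat \<Rightarrow> int"
    unfolding Collect_less_2 c that by simp
  ultimately show ?thesis
    by (intro exI [of _ "\<lambda>i. if i = 0 then 0 else c"] conjI) simp_all
qed

text \<open>
  The element \<open>(a, b)\<close> has order \<open>4\<close>, \<open>2 * p\<close> or \<open>2\<close>, in the order of the alternatives.  If it
  were a generator, \<open>A\<close> would be the subgroup of index two, which has no element with odd second
  coordinate.
\<close>

lemma tiles_pair_right_cases:
  assumes p: "prime p" "odd p" and A: "A \<subseteq> carrier (Zp_Z4 p)" "elt p 0 0 \<in> A"
    and t: "tiles p A {elt p 0 0, elt p a b}" and ab: "elt p a b \<noteq> elt p 0 0" and odd: "\<exists>s\<in>A. odd (snd s)"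
  shows "(\<exists>(\<alpha> :: nat \<Rightarrow> int) (l :: nat \<Rightarrow> int). \<alpha> 0 = 0 \<and> l 0 = 0 \<and>
       A = {elt p (int i) (\<alpha> i + 2 * int j) | i j. i \<in> {0..<p} \<and> j \<in> {0..<2}} \<and>
       {elt p 0 0, elt p a b} = {elt p 0 (int i + 2 * l i) | i. i \<in> {0..<2}}) \<or>
    (\<exists>(\<alpha> :: nat \<Rightarrow> int) (l :: nat \<Rightarrow> int). \<alpha> 0 = 0 \<and> l 0 = 0 \<and>
       A = {elt p (int j) (int i + 2 * \<alpha> i) | i j. i \<in> {0..<2} \<and> j \<in> {0..<p}} \<and>
       {elt p 0 0, elt p a b} = {elt p (l i) (2 * int i) | i. i \<in> {0..<2}}) \<or>
    (\<exists>\<alpha> :: nat \<Rightarrow> nat \<Rightarrow> int. \<alpha> 0 0 = 0 \<and>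
       A = {elt p (int i) (int j + 2 * \<alpha> i j) | i j. i \<in> {0..<p} \<and> j \<in> {0..<2}} \<and>
       {elt p 0 0, elt p a b} = {elt p 0 (2 * int i) | i. i \<in> {0..<2}})"
    (is "?F3 \<or> ?F4 \<or> ?F5")
proof -
  have p0: "p > 0" using p by (simp add: prime_gt_0_nat)
  define P where "P x y \<longleftrightarrow> elt p x y \<in> A" for x y
  have per: "P (x + int p) y \<longleftrightarrow> P x y" "P x (y + 4) \<longleftrightarrow> P x y" for x y
    by (simp_all only: P_def elt_periodic)
  have P0: "P 0 0" using A(2) by (simp only: P_def)
  have alt: "P x y \<longleftrightarrow> \<not> P (x - a) (y - b)" for x y
    using t unfolding tiles_pair_iff [OF ab] P_def by blast
  have Pmod: "P (int (nat (x mod int p))) y \<longleftrightarrow> P x y" for x y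
    using p0 by (simp add: P_def)
  have int_nat_mod_2: "int (nat (y mod 2)) = y mod 2" for y :: int by simp
  show ?thesis
  proof (rule alternating_function_cases [of p P a b, OF p per P0 alt])
    assume "\<And>x y. P x y \<longleftrightarrow> even y"
    moreover obtain s where "s \<in> A" "odd (snd s)" using odd by blast
    moreover from this have "elt p (fst s) (snd s) \<in> A"
      using elt_fst_snd [OF p0, of s] A(1) by auto
    ultimately show ?thesis unfolding P_def by blast
  next
    assume a: "int p dvd a" and b: "odd b" and P: "\<And>x y. P x y \<longleftrightarrow> (even y \<longleftrightarrow> P x 0)"
    define \<alpha> :: "nat \<Rightarrow> int" where "\<alpha> i = (if P (int i) 0 then 0 else 1)" for i
    define l :: "nat \<Rightarrow> int" where "l i = (if i = 0 then 0 else (b - 1) div 2)" for i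
    have "A = {elt p (int i) (\<alpha> i + 2 * int j) | i j. i \<in> {0..<p} \<and> j \<in> {0..<2}}" (is "A = ?A")
    proof (rule subset_carrier_eqI [OF p0 A(1)])
      show "?A \<subseteq> carrier (Zp_Z4 p)" by (rule elt_image_subset [OF p0])
      fix x y
      have "elt p x y \<in> A \<longleftrightarrow> even (y - \<alpha> (nat (x mod int p)))"
        using P [of x y] unfolding P_def [symmetric] \<alpha>_def Pmod by simp
      then show "elt p x y \<in> A \<longleftrightarrow> elt p x y \<in> ?A"
        by (simp only: elt_even_column_iff [OF p0])
    qed
    moreover have "1 + 2 * ((b - 1) div 2) = b" using b by simp
    then have "elt p 0 (1 + 2 * l 1) = elt p a b"
      using a by (simp add: l_def elt_eq_iff dvd_eq_mod_eq_0)
    then have "{elt p 0 0, elt p a b} = {elt p 0 (int i + 2 * l i) | i. i \<in> {0..<2}}"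
      unfolding Collect_less_2 by (simp add: l_def)
    moreover have "\<alpha> 0 = 0" "l 0 = 0" using P0 by (simp_all add: \<alpha>_def l_def)
    ultimately have ?F3 by (intro exI conjI)
    then show ?thesis by (rule disjI1)
  next
    assume a: "int p dvd a" and b: "b mod 4 = 2" and P: "\<And>x y. P x (y + 2) \<longleftrightarrow> \<not> P x y"
    define \<alpha> :: "nat \<Rightarrow> nat \<Rightarrow> int" where "\<alpha> i j = (if P (int i) (int j) then 0 else 1)" for i j
    have "A = {elt p (int i) (int j + 2 * \<alpha> i j) | i j. i \<in> {0..<p} \<and> j \<in> {0..<2}}" (is "A = ?A")
    proof (rule subset_carrier_eqI [OF p0 A(1)])
      show "?A \<subseteq> carrier (Zp_Z4 p)" by (rule elt_image_subset [OF p0])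
      show "elt p x y \<in> A \<longleftrightarrow> elt p x y \<in> ?A" for x y
        using half_turn_iff [of "P x", OF per(2) P, of y]
        unfolding elt_half_turn_columns_iff [OF p0] \<alpha>_def Pmod int_nat_mod_2 P_def [symmetric] .
    qed
    moreover have "elt p a b = elt p 0 2" using a b by (simp add: elt_eq_iff dvd_eq_mod_eq_0)
    then have "{elt p 0 0, elt p a b} = {elt p 0 (2 * int i) | i. i \<in> {0..<2}}"
      unfolding Collect_less_2 by simp
    moreover have "\<alpha> 0 0 = 0" using P0 by (simp add: \<alpha>_def)
    ultimately have ?F5 by (intro exI conjI)
    then show ?thesis by (intro disjI2)
  next
    assume a: "\<not> int p dvd a" and b: "b mod 4 = 2"
      and const: "\<And>x y. P x y \<longleftrightarrow> P 0 y" and P: "\<And>x y. P x (y + 2) \<longleftrightarrow> \<not> P x y"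
    define \<alpha> :: "nat \<Rightarrow> int" where "\<alpha> j = (if P 0 (int j) then 0 else 1)" for j
    define l :: "nat \<Rightarrow> int" where "l i = (if i = 0 then 0 else a)" for i
    have "A = {elt p (int j) (int i + 2 * \<alpha> i) | i j. i \<in> {0..<2} \<and> j \<in> {0..<p}}" (is "A = ?A")
    proof (rule subset_carrier_eqI [OF p0 A(1)])
      show "?A \<subseteq> carrier (Zp_Z4 p)" by (rule elt_image_subset [OF p0])
      show "elt p x y \<in> A \<longleftrightarrow> elt p x y \<in> ?A" for x y
        using const [of x y] half_turn_iff [of "P 0", OF per(2) P, of y]
        unfolding elt_half_turn_rows_iff [OF p0] \<alpha>_def int_nat_mod_2 P_def [symmetric] by (rule trans)
    qed
    moreover have "elt p a b = elt p (l 1) 2" using b by (simp add: elt_eq_iff l_def)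
    then have "{elt p 0 0, elt p a b} = {elt p (l i) (2 * int i) | i. i \<in> {0..<2}}"
      unfolding Collect_less_2 by (simp add: l_def)
    moreover have "\<alpha> 0 = 0" "l 0 = 0" using P0 by (simp_all add: \<alpha>_def l_def)
    ultimately have ?F4 by (intro exI conjI)
    then show ?thesis by (intro disjI2 disjI1)
  qed
qed

text \<open>
  An odd second coordinate in \<open>A\<close> is an odd value of \<open>\<alpha>\<close>, which leaves only the alternative that \<open>\<beta>\<close>
  vanishes.
\<close>

lemma tiles_p_4_imp:
  assumes p: "prime p" "odd p" and A: "A \<subseteq> carrier (Zp_Z4 p)" "elt p 0 0 \<in> A"
    and B: "B \<subseteq> carrier (Zp_Z4 p)" "elt p 0 0 \<in> B"
    and t: "tiles p A B" and card: "card A = p" "card B = 4" and odd: "\<exists>s\<in>A. odd (snd s)"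
  shows "\<exists>\<alpha> :: nat \<Rightarrow> int. \<alpha> 0 = 0 \<and> A = {elt p (int i) (\<alpha> i) | i. i \<in> {0..<p}} \<and>
    B = {elt p 0 (int i) | i. i \<in> {0..<4}}"
proof -
  have p0: "p > 0" using p by (simp add: prime_gt_0_nat)
  obtain \<alpha> \<beta> where z: "\<alpha> 0 = 0" "\<beta> 0 = 0"
    and memA: "\<And>x y. elt p x y \<in> A \<longleftrightarrow> y mod 4 = \<alpha> (x mod int p) mod 4"
    and memB: "\<And>x y. elt p x y \<in> B \<longleftrightarrow> x mod int p = \<beta> (y mod 4) mod int p"
    and cases: "(\<forall>x. \<alpha> x mod 4 = 0) \<or>
      (\<forall>x. even (\<alpha> x)) \<and> \<beta> 2 mod int p = 0 \<and> \<beta> 3 mod int p = \<beta> 1 mod int p \<or>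
      (\<forall>j\<in>{0..<4}. \<beta> j mod int p = 0)"
    by (rule tiles_4_p_structure [OF p A(1) B(1) t card A(2) B(2)]) (rule that)
  obtain s where s: "s \<in> A" "odd (snd s)" using odd by blast
  then have "elt p (fst s) (snd s) \<in> A" using elt_fst_snd [OF p0, of s] A(1) by auto
  then have "snd s mod 4 = \<alpha> (fst s mod int p) mod 4" by (simp only: memA)
  then have "odd (\<alpha> (fst s mod int p))"
    using s(2) even_mod_4 [of "snd s"] even_mod_4 [of "\<alpha> (fst s mod int p)"] by simp
  then have \<beta>: "\<beta> j mod int p = 0" if "j \<in> {0..<4}" for j
    using cases that even_mod_4 by (metis even_zero)
  have "A = {elt p (int i) (\<alpha> (int i)) | i. i \<in> {0..<p}}" (is "A = ?A")
  proof (rule subset_carrier_eqI [OF p0 A(1)])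
    show "?A \<subseteq> carrier (Zp_Z4 p)" by (rule elt_image_subset [OF p0])
    show "elt p x y \<in> A \<longleftrightarrow> elt p x y \<in> ?A" for x y
    proof -
      have "int (nat (x mod int p)) = x mod int p" using p0 by simp
      then show ?thesis unfolding elt_column_iff [OF p0] memA by (simp only:)
    qed
  qed
  moreover have "B = {elt p 0 (int i) | i. i \<in> {0..<4}}" (is "B = ?B")
  proof (rule subset_carrier_eqI [OF p0 B(1)])
    show "?B \<subseteq> carrier (Zp_Z4 p)" by (rule elt_image_subset [OF p0])
    show "elt p x y \<in> B \<longleftrightarrow> elt p x y \<in> ?B" for x y
      unfolding elt_row_iff [where f = "\<lambda>_. 0"] memB using \<beta> [of "y mod 4"] by simp
  qed
  ultimately show ?thesis using z by (intro exI [of _ "\<lambda>i. \<alpha> (int i)"] conjI) simp_all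
qed

text \<open>
  Here \<open>A\<close> is the factor with one element in each row, and its nonzero first coordinate is a nonzero
  value of \<open>\<beta>\<close>.
\<close>

lemma tiles_4_p_cases:
  assumes p: "prime p" "odd p" and A: "A \<subseteq> carrier (Zp_Z4 p)" "elt p 0 0 \<in> A"
    and B: "B \<subseteq> carrier (Zp_Z4 p)" "elt p 0 0 \<in> B"
    and t: "tiles p A B" and card: "card A = 4" "card B = p" and nz: "\<exists>s\<in>A. fst s \<noteq> 0"
  shows "(\<exists>(\<alpha> :: nat \<Rightarrow> int) (l :: nat \<Rightarrow> int). \<alpha> 0 = 0 \<and> l 0 = 0 \<and>
       A = {elt p (\<alpha> i) (int i + 2 * int j) | i j. i \<in> {0..<2} \<and> j \<in> {0..<2}} \<and>
       B = {elt p (int i) (2 * l i) | i. i \<in> {0..<p}}) \<or>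
    (\<exists>\<alpha> :: nat \<Rightarrow> int. \<alpha> 0 = 0 \<and>
       A = {elt p (\<alpha> i) (int i) | i. i \<in> {0..<4}} \<and>
       B = {elt p (int i) 0 | i. i \<in> {0..<p}})" (is "?F6 \<or> ?F7")
proof -
  have p0: "p > 0" using p by (simp add: prime_gt_0_nat)
  obtain \<alpha> \<beta> where z: "\<alpha> 0 = 0" "\<beta> 0 = 0"
    and memB: "\<And>x y. elt p x y \<in> B \<longleftrightarrow> y mod 4 = \<alpha> (x mod int p) mod 4"
    and memA: "\<And>x y. elt p x y \<in> A \<longleftrightarrow> x mod int p = \<beta> (y mod 4) mod int p"
    and cases: "(\<forall>x. \<alpha> x mod 4 = 0) \<or>
      (\<forall>x. even (\<alpha> x)) \<and> \<beta> 2 mod int p = 0 \<and> \<beta> 3 mod int p = \<beta> 1 mod int p \<or>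
      (\<forall>j\<in>{0..<4}. \<beta> j mod int p = 0)"
    by (rule tiles_4_p_structure [OF p B(1) A(1) tiles_commute [OF p0 A(1) B(1) t] card(2,1) B(2) A(2)])
      (rule that)
  have nat_p: "int (nat (x mod int p)) = x mod int p" for x using p0 by simp
  have nat_2: "int (nat (y mod 2)) = y mod 2" for y :: int by simp
  have nat_4: "int (nat (y mod 4)) = y mod 4" for y :: int by simp
  show ?thesis
    using cases
  proof (elim disjE conjE)
    assume *: "\<forall>x. \<alpha> x mod 4 = 0"
    have "A = {elt p (\<beta> (int i)) (int i) | i. i \<in> {0..<4}}" (is "A = ?A")
    proof (rule subset_carrier_eqI [OF p0 A(1)])
      show "?A \<subseteq> carrier (Zp_Z4 p)" by (rule elt_image_subset [OF p0])
      show "elt p x y \<in> A \<longleftrightarrow> elt p x y \<in> ?A" for x y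
        unfolding elt_row_iff nat_4 memA ..
    qed
    moreover have "B = {elt p (int i) 0 | i. i \<in> {0..<p}}" (is "B = ?B")
    proof (rule subset_carrier_eqI [OF p0 B(1)])
      show "?B \<subseteq> carrier (Zp_Z4 p)" by (rule elt_image_subset [OF p0])
      show "elt p x y \<in> B \<longleftrightarrow> elt p x y \<in> ?B" for x y
        unfolding elt_column_iff [where g = "\<lambda>_. 0", OF p0] memB using * by simp
    qed
    ultimately have ?F7 using z by (intro exI [of _ "\<lambda>i. \<beta> (int i)"] conjI) simp_all
    then show ?thesis by (rule disjI2)
  next
    assume even: "\<forall>x. even (\<alpha> x)" and 2: "\<beta> 2 mod int p = 0" and 3: "\<beta> 3 mod int p = \<beta> 1 mod int p"
    have \<beta>: "\<beta> (y mod 4) mod int p = \<beta> (y mod 2) mod int p" for y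
    proof -
      have "y mod 2 = y mod 4 mod 2" by (simp add: mod_mod_cancel)
      then show ?thesis using 2 3 z by (cases y rule: mod_4_cases) simp_all
    qed
    have "A = {elt p (\<beta> (int i)) (int i + 2 * int j) | i j. i \<in> {0..<2} \<and> j \<in> {0..<2}}" (is "A = ?A")
    proof (rule subset_carrier_eqI [OF p0 A(1)])
      show "?A \<subseteq> carrier (Zp_Z4 p)" by (rule elt_image_subset [OF p0])
      show "elt p x y \<in> A \<longleftrightarrow> elt p x y \<in> ?A" for x y
        unfolding elt_parity_row_iff nat_2 memA \<beta> ..
    qed
    moreover have "B = {elt p (int i) (2 * (\<alpha> (int i) div 2)) | i. i \<in> {0..<p}}" (is "B = ?B")
    proof (rule subset_carrier_eqI [OF p0 B(1)])
      show "?B \<subseteq> carrier (Zp_Z4 p)" by (rule elt_image_subset [OF p0])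
      have half: "2 * (\<alpha> x div 2) = \<alpha> x" for x
        by (rule dvd_mult_div_cancel) (rule even [rule_format])
      show "elt p x y \<in> B \<longleftrightarrow> elt p x y \<in> ?B" for x y
        unfolding elt_column_iff [OF p0] nat_p memB half ..
    qed
    ultimately have ?F6
      using z by (intro exI [of _ "\<lambda>i. \<beta> (int i)"] exI [of _ "\<lambda>i. \<alpha> (int i) div 2"] conjI) simp_all
    then show ?thesis by (rule disjI1)
  next
    assume *: "\<forall>j\<in>{0..<4}. \<beta> j mod int p = 0"
    obtain s where s: "s \<in> A" "fst s \<noteq> 0" using nz by blast
    then have "elt p (fst s) (snd s) \<in> A" using elt_fst_snd [OF p0, of s] A(1) by auto
    then have "fst s mod int p = 0" using * by (simp add: memA)
    moreover have "fst s mod int p = fst s" using s(1) A(1) p0 by (auto simp: carrier_Zp_Z4)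
    ultimately show ?thesis using s(2) by simp
  qed
qed

theorem theorem6p4:
  fixes p :: nat and S S\<^sub>0 C :: "(int \<times> int) set"
  assumes "prime p" and "odd p"
    and "S \<subset> carrier (Zp_Z4 p) - {\<one>\<^bsub>Zp_Z4 p\<^esub>}"
    and "generate (Zp_Z4 p) S = carrier (Zp_Z4 p)"
    and "S\<^sub>0 = S \<union> {\<one>\<^bsub>Zp_Z4 p\<^esub>}"
    and "\<one>\<^bsub>Zp_Z4 p\<^esub> \<in> C" and "C \<subseteq> carrier (Zp_Z4 p)"
  shows "perfect_code (with_proj (cayley_digraph (Zp_Z4 p) S)) C \<longleftrightarrow>
    (\<exists>\<alpha> :: nat \<Rightarrow> int. \<alpha> 0 = 0 \<and>
       S\<^sub>0 = {elt p (\<alpha> i) (int i + 2 * \<alpha> i) | i. i \<in> {0..<2}} \<and>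
       C = {elt p (int i) (2 * int j) | i j. i \<in> {0..<p} \<and> j \<in> {0..<2}}) \<or>
    (\<exists>\<alpha> :: nat \<Rightarrow> int. \<alpha> 0 = 0 \<and>
       S\<^sub>0 = {elt p (int i) (\<alpha> i) | i. i \<in> {0..<p}} \<and>
       C = {elt p 0 (int i) | i. i \<in> {0..<4}}) \<or>
    (\<exists>(\<alpha> :: nat \<Rightarrow> int) (l :: nat \<Rightarrow> int). \<alpha> 0 = 0 \<and> l 0 = 0 \<and>
       S\<^sub>0 = {elt p (int i) (\<alpha> i + 2 * int j) | i j. i \<in> {0..<p} \<and> j \<in> {0..<2}} \<and>
       C = {elt p 0 (int i + 2 * l i) | i. i \<in> {0..<2}}) \<or>
    (\<exists>(\<alpha> :: nat \<Rightarrow> int) (l :: nat \<Rightarrow> int). \<alpha> 0 = 0 \<and> l 0 = 0 \<and>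
       S\<^sub>0 = {elt p (int j) (int i + 2 * \<alpha> i) | i j. i \<in> {0..<2} \<and> j \<in> {0..<p}} \<and>
       C = {elt p (l i) (2 * int i) | i. i \<in> {0..<2}}) \<or>
    (\<exists>\<alpha> :: nat \<Rightarrow> nat \<Rightarrow> int. \<alpha> 0 0 = 0 \<and>
       S\<^sub>0 = {elt p (int i) (int j + 2 * \<alpha> i j) | i j. i \<in> {0..<p} \<and> j \<in> {0..<2}} \<and>
       C = {elt p 0 (2 * int i) | i. i \<in> {0..<2}}) \<or>
    (\<exists>(\<alpha> :: nat \<Rightarrow> int) (l :: nat \<Rightarrow> int). \<alpha> 0 = 0 \<and> l 0 = 0 \<and>
       S\<^sub>0 = {elt p (\<alpha> i) (int i + 2 * int j) | i j. i \<in> {0..<2} \<and> j \<in> {0..<2}} \<and>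
       C = {elt p (int i) (2 * l i) | i. i \<in> {0..<p}}) \<or>
    (\<exists>\<alpha> :: nat \<Rightarrow> int. \<alpha> 0 = 0 \<and>
       S\<^sub>0 = {elt p (\<alpha> i) (int i) | i. i \<in> {0..<4}} \<and>
       C = {elt p (int i) 0 | i. i \<in> {0..<p}})"
    (is "?code \<longleftrightarrow> ?F1 \<or> ?F2 \<or> ?F3 \<or> ?F4 \<or> ?F5 \<or> ?F6 \<or> ?F7")
proof -
  note p = assms(1,2)
  have p0: "p > 0" using p(1) by (rule prime_gt_0_nat)
  have one: "\<one>\<^bsub>Zp_Z4 p\<^esub> = elt p 0 0" by (rule one_Zp_Z4)
  have S: "S \<subseteq> carrier (Zp_Z4 p)" using assms(3) by blast
  have S0: "S\<^sub>0 \<subseteq> carrier (Zp_Z4 p)" "elt p 0 0 \<in> S\<^sub>0"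
    using S assms(5) elt_in_carrier [OF p0] unfolding one by blast+
  have C: "C \<subseteq> carrier (Zp_Z4 p)" "elt p 0 0 \<in> C"
    using assms(6,7) unfolding one by blast+
  have nz: "\<exists>s\<in>S\<^sub>0. fst s \<noteq> 0" and odd: "\<exists>s\<in>S\<^sub>0. odd (snd s)"
    using generate_imp_nonzero_fst_odd_snd [OF prime_gt_1_nat [OF p(1)] S assms(4)] assms(5) by blast+
  have "?code \<longleftrightarrow> tiles p S\<^sub>0 C"
    unfolding assms(5) by (rule perfect_code_iff_tiles [OF p0 C(1)])
  also have "\<dots> \<longleftrightarrow> ?F1 \<or> ?F2 \<or> ?F3 \<or> ?F4 \<or> ?F5 \<or> ?F6 \<or> ?F7"
  proof
    assume t: "tiles p S\<^sub>0 C"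
    have "card S\<^sub>0 * card C = 4 * p" by (rule tiles_card [OF p0 S0(1) C(1) t])
    from factorization_4p [OF p(1) this]
    show "?F1 \<or> ?F2 \<or> ?F3 \<or> ?F4 \<or> ?F5 \<or> ?F6 \<or> ?F7"
    proof (elim disjE conjE)
      assume "card S\<^sub>0 = 1"
      then have "S\<^sub>0 = {elt p 0 0}" using S0(2) by (auto simp: card_1_singleton_iff)
      then have False using nz by simp
      then show ?thesis by (rule FalseE)
    next
      assume "card S\<^sub>0 = 2"
      then obtain a b where ab: "S\<^sub>0 = {elt p 0 0, elt p a b}"
        using pair_containing_0 [OF p0 S0] by blast
      have a: "a mod int p \<noteq> 0" using nz unfolding ab by simp
      have "odd (b mod 4)" using odd unfolding ab by auto
      then have b: "odd b" unfolding even_mod_4 [of b] .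
      have ?F1
        unfolding ab by (rule tiles_pair_left_imp [OF p C t [unfolded ab] a b])
      then show ?thesis by (rule disjI1)
    next
      assume "card S\<^sub>0 = 4" "card C = p"
      then have "?F6 \<or> ?F7" by (intro tiles_4_p_cases [OF p S0 C t] nz)
      then show ?thesis by (rule disjI2 [OF disjI2 [OF disjI2 [OF disjI2 [OF disjI2]]]])
    next
      assume "card S\<^sub>0 = p" "card C = 4"
      then have ?F2 by (intro tiles_p_4_imp [OF p S0 C t] odd)
      then show ?thesis by (rule disjI2 [OF disjI1])
    next
      assume "card C = 2"
      then obtain a b where ab: "C = {elt p 0 0, elt p a b}" "elt p a b \<noteq> elt p 0 0"
        using pair_containing_0 [OF p0 C] by blast
      have "?F3 \<or> ?F4 \<or> ?F5"
        unfolding ab(1) by (rule tiles_pair_right_cases [OF p S0 t [unfolded ab(1)] ab(2) odd])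
      then have "(?F3 \<or> ?F4 \<or> ?F5) \<or> (?F6 \<or> ?F7)" by (rule disjI1)
      then have "?F3 \<or> ?F4 \<or> ?F5 \<or> ?F6 \<or> ?F7" by (simp only: disj_assoc)
      then show ?thesis by (rule disjI2 [OF disjI2])
    next
      assume "card S\<^sub>0 = 4 * p"
      then have "card S\<^sub>0 = card (carrier (Zp_Z4 p))" by (simp only: card_carrier_Zp_Z4 [OF p0])
      moreover have "finite (carrier (Zp_Z4 p))" by (simp add: carrier_Zp_Z4 [OF p0])
      ultimately have "S\<^sub>0 = carrier (Zp_Z4 p)" using S0(1) by (intro card_subset_eq)
      then have False using assms(3,5) by blast
      then show ?thesis by (rule FalseE)
    qed
  next
    assume "?F1 \<or> ?F2 \<or> ?F3 \<or> ?F4 \<or> ?F5 \<or> ?F6 \<or> ?F7"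
    then show "tiles p S\<^sub>0 C"
    proof (elim disjE exE conjE)
      fix \<alpha> :: "nat \<Rightarrow> int"
      assume 0: "\<alpha> 0 = 0" and S\<^sub>0: "S\<^sub>0 = {elt p (\<alpha> i) (int i + 2 * \<alpha> i) | i. i \<in> {0..<2}}"
        and C: "C = {elt p (int i) (2 * int j) | i j. i \<in> {0..<p} \<and> j \<in> {0..<2}}"
      show "tiles p S\<^sub>0 C" unfolding S\<^sub>0 C by (rule generator_pair_tiles [of p \<alpha>, OF p0 0])
    next
      fix \<alpha> :: "nat \<Rightarrow> int"
      assume 0: "\<alpha> 0 = 0" and S\<^sub>0: "S\<^sub>0 = {elt p (int i) (\<alpha> i) | i. i \<in> {0..<p}}"
        and C: "C = {elt p 0 (int i) | i. i \<in> {0..<4}}"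
      show "tiles p S\<^sub>0 C" unfolding S\<^sub>0 C by (rule column_graph_tiles [OF p0])
    next
      fix \<alpha> l :: "nat \<Rightarrow> int"
      assume 0: "\<alpha> 0 = 0" "l 0 = 0" and S\<^sub>0: "S\<^sub>0 = {elt p (int i) (\<alpha> i + 2 * int j) | i j. i \<in> {0..<p} \<and> j \<in> {0..<2}}"
        and C: "C = {elt p 0 (int i + 2 * l i) | i. i \<in> {0..<2}}"
      show "tiles p S\<^sub>0 C" unfolding S\<^sub>0 C by (rule even_columns_tile [of p l \<alpha>, OF p0 0(2)])
    next
      fix \<alpha> l :: "nat \<Rightarrow> int"
      assume 0: "\<alpha> 0 = 0" "l 0 = 0" and S\<^sub>0: "S\<^sub>0 = {elt p (int j) (int i + 2 * \<alpha> i) | i j. i \<in> {0..<2} \<and> j \<in> {0..<p}}"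
        and C: "C = {elt p (l i) (2 * int i) | i. i \<in> {0..<2}}"
      show "tiles p S\<^sub>0 C" unfolding S\<^sub>0 C by (rule half_turn_rows_tile [of p l \<alpha>, OF p0 0(2)])
    next
      fix \<alpha> :: "nat \<Rightarrow> nat \<Rightarrow> int"
      assume 0: "\<alpha> 0 0 = 0" and S\<^sub>0: "S\<^sub>0 = {elt p (int i) (int j + 2 * \<alpha> i j) | i j. i \<in> {0..<p} \<and> j \<in> {0..<2}}"
        and C: "C = {elt p 0 (2 * int i) | i. i \<in> {0..<2}}"
      show "tiles p S\<^sub>0 C" unfolding S\<^sub>0 C by (rule half_turn_columns_tile [OF p0])
    next
      fix \<alpha> l :: "nat \<Rightarrow> int"
      assume 0: "\<alpha> 0 = 0" "l 0 = 0" and S\<^sub>0: "S\<^sub>0 = {elt p (\<alpha> i) (int i + 2 * int j) | i j. i \<in> {0..<2} \<and> j \<in> {0..<2}}"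
        and C: "C = {elt p (int i) (2 * l i) | i. i \<in> {0..<p}}"
      show "tiles p S\<^sub>0 C" unfolding S\<^sub>0 C by (rule parity_rows_tile [OF p0])
    next
      fix \<alpha> :: "nat \<Rightarrow> int"
      assume 0: "\<alpha> 0 = 0" and S\<^sub>0: "S\<^sub>0 = {elt p (\<alpha> i) (int i) | i. i \<in> {0..<4}}"
        and C: "C = {elt p (int i) 0 | i. i \<in> {0..<p}}"
      show "tiles p S\<^sub>0 C" unfolding S\<^sub>0 C by (rule row_graph_tiles [OF p0])
    qed
  qed
  finally show ?thesis .
qed

end
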